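(* Let $G$ be a finitely generated group, let $X$ be a Cayley graph of $G$ corresponding to a finite generating set, and let $K\subset X$ be a compact subgraph such that $X\setminus K$ has at least two distinct unbounded connected components. Then $G$ acts nontrivially and with finite edge stabilisers on a tree $T$.
   Context: An action of $G$ on a (simplicial) tree $T$ by automorphisms is nontrivial if there is no point of $T$ fixed by all of $G$. *)

theory Defs
  imports "HOL-Analysis.Analysis" "HOL-Algebra.Group_Action" "HOL-Algebra.Generated_Groups"
begin

section \<open>Simple graphs and trees\<close>

text \<open>A graph is given by its vertex set and its set of edges, which are two-element sets of
  vertices. Both sets may be infinite.\<close>

definition simple_graph :: "'v set \<Rightarrow> 'v set set \<Rightarrow> bool" where
  "simple_graph V E \<longleftrightarrow> (\<forall>e\<in>E. e \<subseteq> V \<and> card e = 2)"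

definition graph_walk :: "'v set \<Rightarrow> 'v set set \<Rightarrow> 'v list \<Rightarrow> bool" where
  "graph_walk V E xs \<longleftrightarrow> xs \<noteq> [] \<and> set xs \<subseteq> V \<and> successively (\<lambda>u v. {u, v} \<in> E) xs"

definition graph_connected :: "'v set \<Rightarrow> 'v set set \<Rightarrow> bool" where
  "graph_connected V E \<longleftrightarrow>
     V \<noteq> {} \<and> (\<forall>u\<in>V. \<forall>v\<in>V. \<exists>xs. graph_walk V E xs \<and> hd xs = u \<and> last xs = v)"

definition graph_cycle :: "'v set \<Rightarrow> 'v set set \<Rightarrow> 'v list \<Rightarrow> bool" where
  "graph_cycle V E xs \<longleftrightarrow>
     graph_walk V E xs \<and> distinct xs \<and> 3 \<le> length xs \<and> {last xs, hd xs} \<in> E"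

definition simplicial_tree :: "'v set \<Rightarrow> 'v set set \<Rightarrow> bool" where
  "simplicial_tree V E \<longleftrightarrow>
     simple_graph V E \<and> graph_connected V E \<and> (\<nexists>xs. graph_cycle V E xs)"

definition subgraph_of :: "'v set \<Rightarrow> 'v set set \<Rightarrow> 'v set \<Rightarrow> 'v set set \<Rightarrow> bool" where
  "subgraph_of V' E' V E \<longleftrightarrow> simple_graph V' E' \<and> V' \<subseteq> V \<and> E' \<subseteq> E"

text \<open>Only meaningful if \<open>u\<close> and \<open>v\<close> are joined by a walk.\<close>

definition graph_dist :: "'v set \<Rightarrow> 'v set set \<Rightarrow> 'v \<Rightarrow> 'v \<Rightarrow> nat" where
  "graph_dist V E u v =
     (LEAST n. \<exists>xs. graph_walk V E xs \<and> hd xs = u \<and> last xs = v \<and> length xs = Suc n)"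


section \<open>The geometric realisation of a graph\<close>

text \<open>Points are given by barycentric coordinates: \<open>p\<close> assigns nonnegative weights of total
  mass 1 to the vertices, and its support is a single vertex or the two ends of an edge.\<close>

definition geo_supp :: "('v \<Rightarrow> real) \<Rightarrow> 'v set" where
  "geo_supp p = {v. p v \<noteq> 0}"

definition geo_simplices :: "'v set \<Rightarrow> 'v set set \<Rightarrow> 'v set set" where
  "geo_simplices V E = (\<lambda>v. {v}) ` V \<union> E"

definition geo_points :: "'v set \<Rightarrow> 'v set set \<Rightarrow> ('v \<Rightarrow> real) set" where
  "geo_points V E =
     {p. geo_supp p \<in> geo_simplices V E \<and> (\<forall>v. 0 \<le> p v) \<and> (\<Sum>v\<in>geo_supp p. p v) = 1}"

text \<open>The point at parameter \<open>t\<close> on the edge from \<open>u\<close> to \<open>v\<close>.\<close>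

definition edge_point :: "'v \<Rightarrow> 'v \<Rightarrow> real \<Rightarrow> 'v \<Rightarrow> real" where
  "edge_point u v t = (\<lambda>w. if w = u then 1 - t else if w = v then t else 0)"

text \<open>The weak (CW) topology: a set is open iff its trace on each closed edge is open. For a
  locally finite graph, such as the Cayley graph of a finite generating set, this is also the
  topology of the path metric.\<close>

definition geo_open :: "'v set \<Rightarrow> 'v set set \<Rightarrow> ('v \<Rightarrow> real) set \<Rightarrow> bool" where
  "geo_open V E U \<longleftrightarrow> U \<subseteq> geo_points V E \<and>
     (\<forall>u v. {u, v} \<in> E \<longrightarrow>
        openin (top_of_set {0..1}) {t \<in> {0..1}. edge_point u v t \<in> U})"

definition geo_topology :: "'v set \<Rightarrow> 'v set set \<Rightarrow> ('v \<Rightarrow> real) topology" where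
  "geo_topology V E = topology (geo_open V E)"

lemma istopology_geo_open: "istopology (geo_open V E)"
  unfolding istopology_def
proof (intro conjI allI impI)
  fix S T assume S: "geo_open V E S" and T: "geo_open V E T"
  have eq: "{t \<in> {0..1}. edge_point u v t \<in> S \<inter> T} =
      {t \<in> {0..1}. edge_point u v t \<in> S} \<inter> {t \<in> {0..1}. edge_point u v t \<in> T}" for u v
    by auto
  show "geo_open V E (S \<inter> T)"
    unfolding geo_open_def eq using S T unfolding geo_open_def
    by (meson inf.coboundedI1 openin_Int)
next
  fix \<K> assume K: "\<forall>K\<in>\<K>. geo_open V E K"
  have eq: "{t \<in> {0..1}. edge_point u v t \<in> \<Union>\<K>} =
      \<Union>((\<lambda>K. {t \<in> {0..1}. edge_point u v t \<in> K}) ` \<K>)" for u v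
    by auto
  show "geo_open V E (\<Union>\<K>)"
    unfolding geo_open_def eq using K unfolding geo_open_def
    by (intro conjI allI impI openin_Union) auto
qed

lemma openin_geo_topology: "openin (geo_topology V E) U \<longleftrightarrow> geo_open V E U"
  by (simp add: geo_topology_def istopology_geo_open topology_inverse')

lemma edge_point_in_geo_points:
  assumes "simple_graph V E" "{u, v} \<in> E" "t \<in> {0..1}"
  shows "edge_point u v t \<in> geo_points V E"
proof -
  have ne: "u \<noteq> v" and V: "u \<in> V" "v \<in> V"
    using assms(1,2) by (auto simp: simple_graph_def)
  have supp: "geo_supp (edge_point u v t) =
      (if t = 0 then {u} else if t = 1 then {v} else {u, v})"
    using ne by (auto simp: geo_supp_def edge_point_def)
  show ?thesis
    unfolding geo_points_def mem_Collect_eq supp using assms ne V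
    by (auto simp: geo_simplices_def edge_point_def)
qed

lemma topspace_geo_topology:
  assumes "simple_graph V E"
  shows "topspace (geo_topology V E) = geo_points V E"
proof -
  have "{t \<in> {0..1}. edge_point u v t \<in> geo_points V E} = {0..1}" if "{u, v} \<in> E" for u v
    using edge_point_in_geo_points[OF assms that] by auto
  then have "geo_open V E (geo_points V E)"
    by (simp add: geo_open_def)
  then show ?thesis
    unfolding topspace_def openin_geo_topology by (auto simp: geo_open_def)
qed

text \<open>The path metric in which every edge has length 1. A point \<open>p\<close> lies at distance
  \<open>1 - p u\<close> from an end \<open>u\<close> of the edge carrying it, and two points of one closed edge lie at half
  the sum of their coordinate differences along that edge.\<close>

definition geo_dist :: "'v set \<Rightarrow> 'v set set \<Rightarrow> ('v \<Rightarrow> real) \<Rightarrow> ('v \<Rightarrow> real) \<Rightarrow> real" where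
  "geo_dist V E p q = Inf
     ({(1 - p u) + real (graph_dist V E u v) + (1 - q v) | u v. u \<in> geo_supp p \<and> v \<in> geo_supp q}
      \<union> {(\<Sum>w\<in>geo_supp p \<union> geo_supp q. \<bar>p w - q w\<bar>) / 2 | e.
            e \<in> geo_simplices V E \<and> geo_supp p \<union> geo_supp q \<subseteq> e})"

definition geo_bounded :: "'v set \<Rightarrow> 'v set set \<Rightarrow> ('v \<Rightarrow> real) set \<Rightarrow> bool" where
  "geo_bounded V E C \<longleftrightarrow> (\<exists>r. \<forall>p\<in>C. \<forall>q\<in>C. geo_dist V E p q \<le> r)"

text \<open>The affine extension of a vertex map to the realisation.\<close>

definition geo_map :: "('v \<Rightarrow> 'w) \<Rightarrow> ('v \<Rightarrow> real) \<Rightarrow> 'w \<Rightarrow> real" where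
  "geo_map f p = (\<lambda>w. \<Sum>v | v \<in> geo_supp p \<and> f v = w. p v)"


section \<open>Cayley graphs and group actions on graphs\<close>

text \<open>The undirected simple Cayley graph, with vertex set \<open>carrier G\<close>.\<close>

definition cayley_edges :: "('a, 'm) monoid_scheme \<Rightarrow> 'a set \<Rightarrow> 'a set set" where
  "cayley_edges G S =
     {{g, g \<otimes>\<^bsub>G\<^esub> s} | g s. g \<in> carrier G \<and> s \<in> S \<and> s \<noteq> \<one>\<^bsub>G\<^esub>}"

lemma (in group) simple_graph_cayley:
  assumes "S \<subseteq> carrier G"
  shows "simple_graph (carrier G) (cayley_edges G S)"
  using assms by (fastforce simp: simple_graph_def cayley_edges_def card_2_iff)

text \<open>Requiring only that edges go to edges suffices: applied to inverses, this shows that each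
  group element acts as a graph automorphism. Edges may be inverted.\<close>

definition graph_action ::
  "('a, 'm) monoid_scheme \<Rightarrow> 'v set \<Rightarrow> 'v set set \<Rightarrow> ('a \<Rightarrow> 'v \<Rightarrow> 'v) \<Rightarrow> bool" where
  "graph_action G V E \<phi> \<longleftrightarrow>
     group_action G V \<phi> \<and> (\<forall>g\<in>carrier G. \<forall>e\<in>E. \<phi> g ` e \<in> E)"

definition edge_stabilizer ::
  "('a, 'm) monoid_scheme \<Rightarrow> ('a \<Rightarrow> 'v \<Rightarrow> 'v) \<Rightarrow> 'v set \<Rightarrow> 'a set" where
  "edge_stabilizer G \<phi> e = stabilizer G (\<lambda>g. image (\<phi> g)) e"

text \<open>The fixed point may be any point of the realisation, such as the midpoint of an inverted
  edge.\<close>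

definition nontrivial_action ::
  "('a, 'm) monoid_scheme \<Rightarrow> 'v set \<Rightarrow> 'v set set \<Rightarrow> ('a \<Rightarrow> 'v \<Rightarrow> 'v) \<Rightarrow> bool" where
  "nontrivial_action G V E \<phi> \<longleftrightarrow>
     \<not> (\<exists>p\<in>geo_points V E. \<forall>g\<in>carrier G. geo_map (\<phi> g) p = p)"

end

theory Submission
  imports Defs
begin

text \<open>
  Among the vertex sets with finite edge boundary that are infinite and coinfinite, take those whose
  boundary is as small as possible. Such a minimal cut crosses only finitely many others, and the
  submodularity of the boundary size and of the number of crossings shows that the minimal cuts with
  the fewest crossings are pairwise nested (Dunwoody, Kroen). This family is invariant under the
  group. Its orientations, that is, consistent choices of a side of each cut, are the vertices of a
  tree in which an edge reverses one cut. The stabiliser of an edge preserves the finite boundary of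
  the cut it reverses. Every minimal cut has infinite sides and infinitely many translates, which
  rules out a fixed vertex; a fixed edge would make the group finite.
\<close>

section \<open>Minimal cuts\<close>

text \<open>Uncrossing replaces two crossing cuts by two opposite corners, and these are again cuts
  only if both are infinite; which pair qualifies depends on the cuts, and complementing one cut
  exchanges the two pairs. Comparing boundary sizes shows that the corners are minimal too, but does
  not exclude the crossing. The second count does, because two cuts that cross each other cross
  neither corner. For it to be a count at all, crossings must be finite in number: a minimal cut has
  connected sides, and only finitely many such cuts of a given size pass through one edge. The same
  finiteness keeps distances in the tree finite. The topological hypothesis is used only to produce
  one cut, the set of vertices in an unbounded component. Compactness leaves finitely many vertices
  in \<open>K\<close>, every boundary edge has an end among them, and local finiteness bounds the
  number of such edges. Finite stabilisers come from the freeness of left multiplication: an element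
  is determined by the image of one vertex, and preserving a finite boundary leaves finitely many
  images.\<close>

definition boundary :: "'v set set \<Rightarrow> 'v set \<Rightarrow> 'v set set" where
  "boundary E A = {e \<in> E. e \<inter> A \<noteq> {} \<and> \<not> e \<subseteq> A}"

text \<open>\<open>linked E B\<close> says that the subgraph induced on \<open>B\<close> is connected.\<close>

definition linked :: "'v set set \<Rightarrow> 'v set \<Rightarrow> bool" where
  "linked E B \<longleftrightarrow> (\<forall>C. C \<subset> B \<and> C \<noteq> {} \<longrightarrow> boundary {e \<in> E. e \<subseteq> B} C \<noteq> {})"

text \<open>\<open>P\<close> plays the role of the edge set of a path from \<open>x\<close> to
  \<open>y\<close>, found without naming a path: the vertices for which such a \<open>P\<close>
  exists form a set \<open>R\<close> around \<open>x\<close> with empty boundary, and the hypothesis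
  carries \<open>y\<close> into it. Questions about all cuts that separate two vertices thus become
  questions about finitely many edges.\<close>

lemma finite_separator:
  assumes "\<And>C. x \<in> C \<Longrightarrow> boundary E C = {} \<Longrightarrow> y \<in> C"
  obtains P where "finite P" "P \<subseteq> E" "\<forall>C. (x \<in> C) \<noteq> (y \<in> C) \<longrightarrow> boundary E C \<inter> P \<noteq> {}"
proof -
  define R where "R = {z. \<exists>P. finite P \<and> P \<subseteq> E \<and>
    (\<forall>C. (x \<in> C) \<noteq> (z \<in> C) \<longrightarrow> boundary E C \<inter> P \<noteq> {})}"
  have "x \<in> R" unfolding R_def by auto
  moreover have "boundary E R = {}"
  proof -
    have "w \<in> R" if e: "e \<in> E" and z: "z \<in> e" "z \<in> R" and w: "w \<in> e" for e z w
    proof -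
      obtain P where P: "finite P" "P \<subseteq> E"
        "\<forall>C. (x \<in> C) \<noteq> (z \<in> C) \<longrightarrow> boundary E C \<inter> P \<noteq> {}"
        using z(2) unfolding R_def by blast
      have "boundary E C \<inter> insert e P \<noteq> {}" if "(x \<in> C) \<noteq> (w \<in> C)" for C
      proof (cases "(x \<in> C) = (z \<in> C)")
        case True
        then have "e \<in> boundary E C" using that e z w unfolding boundary_def by blast
        then show ?thesis by blast
      next
        case False
        then show ?thesis using P(3) by blast
      qed
      then show ?thesis
        unfolding R_def using P(1,2) e by (intro CollectI exI[of _ "insert e P"]) auto
    qed
    then show ?thesis unfolding boundary_def by blast
  qed
  ultimately have "y \<in> R" by (rule assms)
  then show thesis using that unfolding R_def by blast
qed

lemma boundary_Diff:
  assumes "\<Union>E \<subseteq> V"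
  shows "boundary E (V - A) = boundary E A"
  using assms unfolding boundary_def by blast

lemma linked_in_side:
  assumes "linked E B" "x \<in> B" "x \<in> C" "boundary {e \<in> E. e \<subseteq> B} C = {}"
  shows "B \<subseteq> C"
proof (rule ccontr)
  assume "\<not> B \<subseteq> C"
  then have "boundary {e \<in> E. e \<subseteq> B} (B \<inter> C) \<noteq> {}"
    using assms(1-3) unfolding linked_def by blast
  then show False using assms(4) unfolding boundary_def by blast
qed

text \<open>Deleting \<open>e\<close> keeps both sides of such a cut linked and lowers the size of the boundary, and
  unless \<open>e\<close> is a bridge the boundary of the cut still meets a finite set of edges that joins the
  ends of \<open>e\<close>.\<close>

lemma finite_linked_cuts_through_edge:
  assumes "simple_graph V E" "e \<in> E"
  shows "finite {B. B \<subseteq> V \<and> linked E B \<and> linked E (V - B) \<and> e \<in> boundary E B \<and>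
    finite (boundary E B) \<and> card (boundary E B) = k}"
  using assms
proof (induction k arbitrary: E e)
  case 0
  then have "{B. B \<subseteq> V \<and> linked E B \<and> linked E (V - B) \<and> e \<in> boundary E B \<and>
      finite (boundary E B) \<and> card (boundary E B) = 0} = {}"
    using card_eq_0_iff by blast
  then show ?case by (simp only: finite.emptyI)
next
  case (Suc k)
  obtain x y where e: "e = {x, y}" "x \<noteq> y" "x \<in> V" "y \<in> V"
    using Suc.prems unfolding simple_graph_def by (metis card_2_iff insert_subset)
  have EV: "\<Union>E \<subseteq> V" using Suc.prems(1) unfolding simple_graph_def by blast
  define F where "F = E - {e}"
  have F: "simple_graph V F" using Suc.prems(1) unfolding F_def simple_graph_def by blast
  let ?T = "\<lambda>E e k. {B. B \<subseteq> V \<and> linked E B \<and> linked E (V - B) \<and> e \<in> boundary E B \<and>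
    finite (boundary E B) \<and> card (boundary E B) = k}"
  have sub: "{f \<in> E. f \<subseteq> B} = {f \<in> F. f \<subseteq> B}" "{f \<in> E. f \<subseteq> V - B} = {f \<in> F. f \<subseteq> V - B}"
    if "e \<in> boundary E B" for B
  proof -
    have "\<not> e \<subseteq> B" "\<not> e \<subseteq> V - B" using that unfolding boundary_def by auto
    then show "{f \<in> E. f \<subseteq> B} = {f \<in> F. f \<subseteq> B}" "{f \<in> E. f \<subseteq> V - B} = {f \<in> F. f \<subseteq> V - B}"
      unfolding F_def by auto
  qed
  show ?case
  proof (cases "\<forall>C. x \<in> C \<longrightarrow> boundary F C = {} \<longrightarrow> y \<in> C")
    case True
    then have sep: "\<And>C. x \<in> C \<Longrightarrow> boundary F C = {} \<Longrightarrow> y \<in> C" by simp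
    obtain P where P: "finite P" "P \<subseteq> F"
      "\<forall>C. (x \<in> C) \<noteq> (y \<in> C) \<longrightarrow> boundary F C \<inter> P \<noteq> {}"
      by (rule finite_separator[OF sep])
    have "?T E e (Suc k) \<subseteq> (\<Union>f\<in>P. ?T F f k)"
    proof
      fix B assume B: "B \<in> ?T E e (Suc k)"
      then have "(x \<in> B) \<noteq> (y \<in> B)" unfolding e boundary_def by auto
      then obtain f where f: "f \<in> P" "f \<in> boundary F B" using P(3) by blast
      have "boundary F B = boundary E B - {e}" unfolding F_def boundary_def by blast
      moreover have "linked F B" "linked F (V - B)"
        using B sub[of B] unfolding linked_def by auto
      ultimately show "B \<in> (\<Union>f\<in>P. ?T F f k)" using B f by auto
    qed
    moreover have "finite (?T F f k)" if "f \<in> P" for f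
      using Suc.IH[OF F, of f] P(2) that by blast
    ultimately show ?thesis using P(1) by (meson finite_UN_I finite_subset)
  next
    case False
    then obtain C where C: "x \<in> C" "y \<notin> C" "boundary F C = {}" by blast
    \<comment> \<open>Here \<open>e\<close> is a bridge: no edge of \<open>F\<close> leaves
      \<open>C\<close>. The linked side through \<open>x\<close> stays in \<open>C\<close>, and the
      other side, which contains \<open>y\<close>, stays outside, so the cut is forced.\<close>
    have side: "B = V \<inter> C" if B: "B \<subseteq> V" "linked E B" "linked E (V - B)" "e \<in> boundary E B" "x \<in> B" for B
    proof -
      have y: "y \<in> V - B" using B e unfolding boundary_def by auto
      have "boundary {f \<in> F. f \<subseteq> B} C \<subseteq> boundary F C"
        "boundary {f \<in> F. f \<subseteq> V - B} (V - C) \<subseteq> boundary F C"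
        unfolding boundary_def by auto
      then have none: "boundary {f \<in> E. f \<subseteq> B} C = {}" "boundary {f \<in> E. f \<subseteq> V - B} (V - C) = {}"
        using C(3) unfolding sub[OF B(4)] by auto
      have "B \<subseteq> C" by (rule linked_in_side[OF B(2,5) C(1) none(1)])
      moreover have "V - B \<subseteq> V - C" using linked_in_side[OF B(3) y _ none(2)] y C(2) by auto
      ultimately show ?thesis using B(1) by blast
    qed
    have "?T E e (Suc k) \<subseteq> {V \<inter> C, V - (V \<inter> C)}"
    proof
      fix B assume B: "B \<in> ?T E e (Suc k)"
      then consider "x \<in> B" | "x \<in> V - B" using e by blast
      then show "B \<in> {V \<inter> C, V - (V \<inter> C)}"
      proof cases
        case 1
        then show ?thesis using side[of B] B by blast
      next
        case 2
        have "V - (V - B) = B" using B by blast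
        then have "V - B = V \<inter> C"
          using side[of "V - B"] B 2 boundary_Diff[OF EV, of B] by auto
        then show ?thesis using B by blast
      qed
    qed
    then show ?thesis by (rule finite_subset) simp
  qed
qed

text \<open>An edge cut by both \<open>A \<inter> B\<close> and \<open>A \<union> B\<close> runs
  from inside both sets to outside both. Together the inclusions are the submodularity of the edge
  boundary, in the form that \<open>card_sum_le\<close> takes.\<close>

lemma boundary_Int_Un_subset:
  "boundary E (A \<inter> B) \<union> boundary E (A \<union> B) \<subseteq> boundary E A \<union> boundary E B"
  "boundary E (A \<inter> B) \<inter> boundary E (A \<union> B) \<subseteq> boundary E A \<inter> boundary E B"
  unfolding boundary_def by blast+

text \<open>The inclusions say that no element is counted more often in \<open>C\<close> and
  \<open>D\<close> than in \<open>A\<close> and \<open>B\<close>. This is applied to edge boundaries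
  and again to sets of crossing cuts.\<close>

lemma card_sum_le:
  assumes "finite A" "finite B" "C \<union> D \<subseteq> A \<union> B" "C \<inter> D \<subseteq> A \<inter> B"
  shows "card C + card D \<le> card A + card B"
proof -
  have fin: "finite C" "finite D" using assms by (auto intro: finite_subset)
  have "card C + card D = card (C \<union> D) + card (C \<inter> D)" by (rule card_Un_Int[OF fin])
  also have "\<dots> \<le> card (A \<union> B) + card (A \<inter> B)"
    using assms by (intro add_mono card_mono) auto
  also have "\<dots> = card A + card B" using card_Un_Int[OF assms(1,2)] by simp
  finally show ?thesis .
qed

section \<open>Uncrossing of minimal cuts in a connected graph with more than one end\<close>

locale multi_ended_graph =
  fixes V :: "'v set" and E :: "'v set set"
  assumes simple: "simple_graph V E"
    and connected: "\<And>C. C \<subseteq> V \<Longrightarrow> C \<noteq> {} \<Longrightarrow> boundary E C = {} \<Longrightarrow> C = V"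
    and ends: "\<exists>A\<subseteq>V. infinite A \<and> infinite (V - A) \<and> finite (boundary E A)"
begin

definition cut :: "'v set \<Rightarrow> bool" where
  "cut A \<longleftrightarrow> A \<subseteq> V \<and> infinite A \<and> infinite (V - A) \<and> finite (boundary E A)"

definition min_size :: nat where
  "min_size = (LEAST k. \<exists>A. cut A \<and> card (boundary E A) = k)"

definition min_cut :: "'v set \<Rightarrow> bool" where
  "min_cut A \<longleftrightarrow> cut A \<and> card (boundary E A) = min_size"

text \<open>For subsets of \<open>V\<close> this says that one of the four corners is empty, a
  condition unchanged when either set is replaced by its complement.\<close>

definition nested :: "'v set \<Rightarrow> 'v set \<Rightarrow> bool" where
  "nested A B \<longleftrightarrow> A \<subseteq> B \<or> B \<subseteq> A \<or> A \<inter> B = {} \<or> V \<subseteq> A \<union> B"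

definition crossing :: "'v set \<Rightarrow> 'v set set" where
  "crossing A = {B. min_cut B \<and> \<not> nested A B}"

text \<open>Since \<open>card\<close> of an infinite set is 0, this minimum is meaningful only
  because of \<open>finite_crossing\<close>.\<close>

definition min_crossing :: nat where
  "min_crossing = (LEAST k. \<exists>A. min_cut A \<and> card (crossing A) = k)"

definition optimal_cuts :: "'v set set" where
  "optimal_cuts = {A. min_cut A \<and> card (crossing A) = min_crossing}"

lemma edges_subset: "\<Union>E \<subseteq> V"
  using simple unfolding simple_graph_def by blast

text \<open>The only pairs of cases that do not pass to \<open>A \<inter> B\<close> are
  \<open>C \<subseteq> A\<close> with \<open>V \<subseteq> B \<union> C\<close> and its mirror
  image, and they would make \<open>A \<union> B\<close> cover \<open>V\<close>. For
  \<open>A \<union> B\<close> the bad pairs instead make \<open>A\<close> and \<open>B\<close>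
  disjoint.\<close>

lemma nested_Int:
  assumes "nested A C" "nested B C" "\<not> nested A B"
  shows "nested (A \<inter> B) C"
proof -
  have "\<not> (C \<subseteq> A \<and> V \<subseteq> B \<union> C)" "\<not> (C \<subseteq> B \<and> V \<subseteq> A \<union> C)"
    using assms(3) unfolding nested_def by blast+
  moreover have "C \<subseteq> A \<Longrightarrow> C \<subseteq> B \<Longrightarrow> C \<subseteq> A \<inter> B"
    "V \<subseteq> A \<union> C \<Longrightarrow> V \<subseteq> B \<union> C \<Longrightarrow> V \<subseteq> (A \<inter> B) \<union> C"
    "A \<subseteq> C \<or> B \<subseteq> C \<Longrightarrow> A \<inter> B \<subseteq> C"
    "A \<inter> C = {} \<or> B \<inter> C = {} \<Longrightarrow> (A \<inter> B) \<inter> C = {}"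
    by blast+
  ultimately show ?thesis using assms(1,2) unfolding nested_def by argo
qed

lemma nested_Un:
  assumes "nested A C" "nested B C" "\<not> nested A B"
  shows "nested (A \<union> B) C"
proof -
  have "\<not> (A \<subseteq> C \<and> B \<inter> C = {})" "\<not> (B \<subseteq> C \<and> A \<inter> C = {})"
    using assms(3) unfolding nested_def by blast+
  moreover have "A \<subseteq> C \<Longrightarrow> B \<subseteq> C \<Longrightarrow> A \<union> B \<subseteq> C"
    "A \<inter> C = {} \<Longrightarrow> B \<inter> C = {} \<Longrightarrow> (A \<union> B) \<inter> C = {}"
    "C \<subseteq> A \<or> C \<subseteq> B \<Longrightarrow> C \<subseteq> A \<union> B"
    "V \<subseteq> A \<union> C \<or> V \<subseteq> B \<union> C \<Longrightarrow> V \<subseteq> (A \<union> B) \<union> C"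
    by blast+
  ultimately show ?thesis using assms(1,2) unfolding nested_def by argo
qed

text \<open>Read backwards: what crosses both corners crosses \<open>A\<close> and, by symmetry,
  \<open>B\<close>. This is the intersection half of submodularity for crossings;
  \<open>nested_Int\<close> and \<open>nested_Un\<close> give the union half.\<close>

lemma nested_Int_or_Un: "nested A C \<Longrightarrow> nested (A \<inter> B) C \<or> nested (A \<union> B) C"
  unfolding nested_def by (elim disjE) blast+

lemma min_size_le: "cut A \<Longrightarrow> min_size \<le> card (boundary E A)"
  unfolding min_size_def by (rule Least_le) blast

lemma min_cut_exists: "\<exists>A. min_cut A"
  unfolding min_cut_def min_size_def
  by (rule LeastI_ex) (use ends in \<open>auto simp: cut_def\<close>)

lemma optimal_cuts_nonempty: "optimal_cuts \<noteq> {}"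
proof -
  have "\<exists>A. min_cut A \<and> card (crossing A) = min_crossing"
    unfolding min_crossing_def by (rule LeastI_ex) (use min_cut_exists in blast)
  then show ?thesis unfolding optimal_cuts_def by blast
qed

lemma cut_Diff: "cut A \<Longrightarrow> cut (V - A)"
  unfolding cut_def boundary_Diff[OF edges_subset] by (auto simp: double_diff)

lemma min_cut_Diff: "min_cut A \<Longrightarrow> min_cut (V - A)"
  unfolding min_cut_def boundary_Diff[OF edges_subset] by (auto simp: cut_Diff)

lemma crossing_Diff:
  assumes "A \<subseteq> V"
  shows "crossing (V - A) = crossing A"
proof -
  have "nested (V - A) B = nested A B" if "B \<subseteq> V" for B
    using assms that unfolding nested_def by blast
  then show ?thesis unfolding crossing_def min_cut_def cut_def by blast
qed

lemma optimal_cuts_Diff: "A \<in> optimal_cuts \<Longrightarrow> V - A \<in> optimal_cuts"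
  unfolding optimal_cuts_def using min_cut_Diff crossing_Diff
  by (simp add: min_cut_def cut_def)

lemma separator:
  assumes "x \<in> V" "y \<in> V"
  obtains P where "finite P" "P \<subseteq> E" "\<forall>C. (x \<in> C) \<noteq> (y \<in> C) \<longrightarrow> boundary E C \<inter> P \<noteq> {}"
proof (rule finite_separator[of x E y])
  fix C assume C: "x \<in> C" "boundary E C = {}"
  have "boundary E (C \<inter> V) = {}" using C(2) edges_subset unfolding boundary_def by blast
  then have "C \<inter> V = V" using connected[of "C \<inter> V"] C(1) assms(1) by blast
  then show "y \<in> C" using assms(2) by blast
qed (rule that)

text \<open>If \<open>A\<close> split into \<open>C\<close> and \<open>D\<close> with no edge
  between them, \<open>boundary E A\<close> would be shared out between the two parts. One part is
  infinite, hence a cut, and minimality hands it the whole boundary. The other part then has empty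
  boundary, against connectedness.\<close>

lemma linked_min_cut:
  assumes "min_cut A"
  shows "linked E A"
  unfolding linked_def
proof (intro allI impI notI)
  fix C assume C: "C \<subset> A \<and> C \<noteq> {}" and none: "boundary {e \<in> E. e \<subseteq> A} C = {}"
  have A: "A \<subseteq> V" "infinite A" "infinite (V - A)" "finite (boundary E A)"
    "card (boundary E A) = min_size"
    using assms unfolding min_cut_def cut_def by auto
  define D where "D = A - C"
  have D: "D \<subseteq> A" "D \<noteq> {}" "C \<inter> D = {}" "C \<union> D = A" using C unfolding D_def by auto
  have two: "e \<subseteq> A" if e: "e \<in> E" and ne: "e \<inter> C \<noteq> {}" "e \<inter> D \<noteq> {}" for e
  proof -
    obtain a b where "e = {a, b}"
      using simple e unfolding simple_graph_def by (metis card_2_iff)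
    then show ?thesis using ne D by auto
  qed
  have out: "\<not> e \<subseteq> A" if "e \<in> E" "e \<inter> X \<noteq> {}" "\<not> e \<subseteq> X" "X = C \<or> X = D" for e X
    using that none D unfolding boundary_def by blast
  have "boundary E X \<subseteq> boundary E A" if "X = C \<or> X = D" for X
    using out[of _ X] that D(1) C unfolding boundary_def by blast
  then have sub: "boundary E C \<subseteq> boundary E A" "boundary E D \<subseteq> boundary E A" by auto
  have disj: "boundary E C \<inter> boundary E D = {}"
    using two out[of _ C] unfolding boundary_def by blast
  have empty: "boundary E Y = {}"
    if XY: "boundary E X \<subseteq> boundary E A" "boundary E Y \<subseteq> boundary E A"
      "boundary E X \<inter> boundary E Y = {}" "X \<subseteq> A" "infinite X" for X Y
  proof -
    have "V - A \<subseteq> V - X" using XY(4) by blast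
    then have "infinite (V - X)" "X \<subseteq> V" "finite (boundary E X)"
      using finite_subset[of "V - A" "V - X"] finite_subset[OF XY(1)] XY(4) A by auto
    then have "cut X" unfolding cut_def using XY(5) by blast
    then have "card (boundary E A) \<le> card (boundary E X)" using min_size_le A(5) by simp
    then have "boundary E X = boundary E A" using XY(1) A(4) by (simp add: card_seteq)
    then show ?thesis using XY by blast
  qed
  have "infinite C \<or> infinite D" using A(2) D(4) by auto
  then have "boundary E C = {} \<or> boundary E D = {}"
    using empty[of C D] empty[of D C] sub disj D C by blast
  then have "C = V \<or> D = V" using connected[of C] connected[of D] C D A(1) by blast
  then show False using C D A by auto
qed

lemma finite_min_cuts_through_edge:
  assumes "e \<in> E"
  shows "finite {B. min_cut B \<and> e \<in> boundary E B}"
  by (rule finite_subset[OF _ finite_linked_cuts_through_edge[OF simple assms, of min_size]])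
    (auto simp: linked_min_cut min_cut_Diff, auto simp: min_cut_def cut_def)

lemma finite_min_cuts_separating:
  assumes "x \<in> V" "y \<in> V"
  shows "finite {B. min_cut B \<and> (x \<in> B) \<noteq> (y \<in> B)}"
proof -
  obtain P where P: "finite P" "P \<subseteq> E" "\<forall>C. (x \<in> C) \<noteq> (y \<in> C) \<longrightarrow> boundary E C \<inter> P \<noteq> {}"
    by (rule separator[OF assms])
  have "{B. min_cut B \<and> (x \<in> B) \<noteq> (y \<in> B)} \<subseteq> (\<Union>e\<in>P. {B. min_cut B \<and> e \<in> boundary E B})"
    using P(3) by fast
  moreover have "finite (\<Union>e\<in>P. {B. min_cut B \<and> e \<in> boundary E B})"
    using P(1,2) finite_min_cuts_through_edge by blast
  ultimately show ?thesis by (rule finite_subset)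
qed

text \<open>A crossing \<open>B\<close> is linked and meets both sides of \<open>A\<close>, so an
  edge inside \<open>B\<close> crosses \<open>A\<close>; the same holds for \<open>V - B\<close>.
  Hence \<open>B\<close> separates two of the finitely many ends of boundary edges of
  \<open>A\<close>.\<close>

lemma finite_crossing:
  assumes "min_cut A"
  shows "finite (crossing A)"
proof -
  let ?N = "\<Union>(boundary E A)"
  have A: "A \<subseteq> V" "finite (boundary E A)"
    using assms unfolding min_cut_def cut_def by auto
  have N: "?N \<subseteq> V" using edges_subset unfolding boundary_def by blast
  have "finite e" if "e \<in> E" for e
    using simple that unfolding simple_graph_def by (metis card.infinite zero_neq_numeral)
  then have "finite ?N" using A(2) unfolding boundary_def by blast
  have meets: "\<exists>x\<in>?N. x \<in> B" if B: "min_cut B" "A \<inter> B \<noteq> {}" "\<not> B \<subseteq> A" for B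
  proof -
    have "boundary {e \<in> E. e \<subseteq> B} (A \<inter> B) \<noteq> {}"
      using linked_min_cut[OF B(1)] B(2,3) unfolding linked_def by blast
    then show ?thesis unfolding boundary_def by blast
  qed
  have "crossing A \<subseteq> (\<Union>x\<in>?N. \<Union>y\<in>?N. {B. min_cut B \<and> (x \<in> B) \<noteq> (y \<in> B)})"
  proof
    fix B assume "B \<in> crossing A"
    then have B: "min_cut B" "\<not> nested A B" unfolding crossing_def by auto
    obtain x where x: "x \<in> ?N" "x \<in> B"
      using meets[OF B(1)] B(2) unfolding nested_def by blast
    obtain y where y: "y \<in> ?N" "y \<in> V - B"
      using meets[OF min_cut_Diff[OF B(1)]] B(2) A(1) unfolding nested_def by blast
    show "B \<in> (\<Union>x\<in>?N. \<Union>y\<in>?N. {B. min_cut B \<and> (x \<in> B) \<noteq> (y \<in> B)})"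
      using x y B(1) by blast
  qed
  moreover have "finite (\<Union>x\<in>?N. \<Union>y\<in>?N. {B. min_cut B \<and> (x \<in> B) \<noteq> (y \<in> B)})"
    using \<open>finite ?N\<close> finite_min_cuts_separating[OF subsetD[OF N] subsetD[OF N]]
    by (intro finite_UN_I)
  ultimately show ?thesis by (rule finite_subset)
qed

text \<open>If \<open>A\<close> and \<open>B\<close> crossed, both corners would be cuts. Their
  boundaries each have at least the minimal size and together at most twice that size, so both
  corners are minimal cuts, and \<open>min_crossing\<close> bounds their crossings from
  below.\<close>

lemma optimal_corners_not_infinite:
  assumes A: "A \<in> optimal_cuts" and B: "B \<in> optimal_cuts"
    and inf: "infinite (A \<inter> B)" "infinite (V - (A \<union> B))"
  shows "nested A B"
proof (rule ccontr)
  assume cross: "\<not> nested A B"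
  have mA: "min_cut A" "card (crossing A) = min_crossing"
    and mB: "min_cut B" "card (crossing B) = min_crossing"
    using A B unfolding optimal_cuts_def by auto
  have V: "A \<subseteq> V" "B \<subseteq> V" and fin: "finite (boundary E A)" "finite (boundary E B)"
    using mA(1) mB(1) unfolding min_cut_def cut_def by auto
  have fin': "finite (boundary E (A \<inter> B))" "finite (boundary E (A \<union> B))"
    using boundary_Int_Un_subset(1)[of E A B] fin by (meson finite_Un finite_subset)+
  have "infinite (V - A \<inter> B)" "infinite (A \<union> B)"
    using inf by (metis Diff_Int Diff_Un finite_Int finite_Un)+
  then have cuts: "cut (A \<inter> B)" "cut (A \<union> B)"
    using inf V fin' unfolding cut_def by auto
  have "card (boundary E (A \<inter> B)) + card (boundary E (A \<union> B))
      \<le> card (boundary E A) + card (boundary E B)"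
    by (rule card_sum_le[OF fin boundary_Int_Un_subset])
  then have mins: "min_cut (A \<inter> B)" "min_cut (A \<union> B)"
    using min_size_le[OF cuts(1)] min_size_le[OF cuts(2)] cuts mA(1) mB(1)
    unfolding min_cut_def by auto
  have le: "min_crossing \<le> card (crossing C)" if "min_cut C" for C
    unfolding min_crossing_def by (rule Least_le) (use that in blast)
  have ABx: "A \<in> crossing B" "B \<notin> crossing B"
    using mA(1) cross unfolding crossing_def by (auto simp: nested_def)
  \<comment> \<open>Submodularity alone would give no contradiction. The strict drop comes from
    \<open>A\<close> itself, which crosses \<open>B\<close> but neither corner and so may be struck
    from \<open>crossing B\<close>.\<close>
  have "card (crossing (A \<inter> B)) + card (crossing (A \<union> B)) \<le> card (crossing A) + card (crossing B - {A})"
  proof (rule card_sum_le)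
    show "finite (crossing A)" "finite (crossing B - {A})"
      using finite_crossing mA(1) mB(1) by auto
    show "crossing (A \<inter> B) \<union> crossing (A \<union> B) \<subseteq> crossing A \<union> (crossing B - {A})"
    proof
      fix C assume C: "C \<in> crossing (A \<inter> B) \<union> crossing (A \<union> B)"
      have "nested (A \<inter> B) A" "nested (A \<union> B) A" unfolding nested_def by blast+
      then have "C \<noteq> A" using C unfolding crossing_def by blast
      moreover have "min_cut C" using C unfolding crossing_def by auto
      moreover have "\<not> nested A C \<or> \<not> nested B C"
        using C cross nested_Int nested_Un unfolding crossing_def by blast
      ultimately show "C \<in> crossing A \<union> (crossing B - {A})" unfolding crossing_def by blast
    qed
    have "nested (A \<inter> B) A" unfolding nested_def by blast
    moreover have "nested B C \<Longrightarrow> nested (A \<inter> B) C \<or> nested (A \<union> B) C" for C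
      using nested_Int_or_Un[of B C A] by (simp add: Int_commute Un_commute)
    ultimately show "crossing (A \<inter> B) \<inter> crossing (A \<union> B) \<subseteq> crossing A \<inter> (crossing B - {A})"
      using nested_Int_or_Un[of A _ B] unfolding crossing_def by blast
  qed
  moreover have "card (crossing B - {A}) < card (crossing B)"
    using ABx(1) finite_crossing[OF mB(1)] by (rule card_Diff1_less[rotated])
  ultimately show False using le[OF mins(1)] le[OF mins(2)] mA(2) mB(2) by linarith
qed

lemma optimal_cuts_nested:
  assumes A: "A \<in> optimal_cuts" and B: "B \<in> optimal_cuts"
  shows "nested A B"
proof (cases "infinite (A \<inter> B) \<and> infinite (V - (A \<union> B))")
  case True
  then show ?thesis using optimal_corners_not_infinite[OF A B] by blast
next
  case False
  have c: "A \<subseteq> V" "B \<subseteq> V" "infinite A" "infinite (V - A)" "infinite B" "infinite (V - B)"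
    using A B unfolding optimal_cuts_def min_cut_def cut_def by auto
  \<comment> \<open>Each side is the union of two adjacent corners, so a finite corner makes both
    its neighbours infinite. These are opposite corners for the pair \<open>A\<close>,
    \<open>V - B\<close>.\<close>
  have eqs: "A = (A \<inter> B) \<union> (A \<inter> (V - B))" "B = (A \<inter> B) \<union> (V - (A \<union> (V - B)))"
    "V - A = (V - (A \<union> B)) \<union> (V - (A \<union> (V - B)))"
    "V - B = (V - (A \<union> B)) \<union> (A \<inter> (V - B))"
    using c by auto
  have "infinite (A \<inter> (V - B))" "infinite (V - (A \<union> (V - B)))"
    using False c eqs by (metis finite_Un)+
  then have "nested A (V - B)" by (rule optimal_corners_not_infinite[OF A optimal_cuts_Diff[OF B]])
  then show ?thesis using c(1,2) unfolding nested_def by blast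
qed

lemma finite_optimal_cuts_separating:
  assumes "x \<in> V" "y \<in> V"
  shows "finite {A \<in> optimal_cuts. x \<in> A \<and> y \<notin> A}"
  by (rule finite_subset[OF _ finite_min_cuts_separating[OF assms]])
    (auto simp: optimal_cuts_def)

lemma boundary_cut_nonempty:
  assumes "cut A"
  shows "boundary E A \<noteq> {}"
proof
  assume "boundary E A = {}"
  then have "A = V" using connected[of A] assms unfolding cut_def by auto
  then show False using assms unfolding cut_def by auto
qed

end

section \<open>The tree of a nested family\<close>

text \<open>Nonnegative weights cannot cancel. A fixed point of the realisation therefore has an
  invariant support, and only vertices and edges need to be examined.\<close>

lemma geo_supp_geo_map:
  assumes "finite (geo_supp p)" "\<forall>v. 0 \<le> p v"
  shows "geo_supp (geo_map f p) = f ` geo_supp p"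
proof -
  have "geo_map f p w \<noteq> 0 \<longleftrightarrow> w \<in> f ` geo_supp p" for w
  proof -
    have "geo_map f p w = 0 \<longleftrightarrow> (\<forall>v \<in> {v. v \<in> geo_supp p \<and> f v = w}. p v = 0)"
      unfolding geo_map_def using assms by (intro sum_nonneg_eq_0_iff) auto
    then show ?thesis by (auto simp: geo_supp_def)
  qed
  then show ?thesis unfolding geo_supp_def[of "geo_map f p"] by blast
qed

section \<open>Orientations of a nested family as the vertices of a tree\<close>

locale nested_family =
  fixes V :: "'v set" and T :: "'v set set"
  assumes V_nonempty: "V \<noteq> {}"
    and nonempty: "A \<in> T \<Longrightarrow> A \<noteq> {}"
    and subset: "A \<in> T \<Longrightarrow> A \<subseteq> V"
    and compl: "A \<in> T \<Longrightarrow> V - A \<in> T"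
    and nested: "A \<in> T \<Longrightarrow> B \<in> T \<Longrightarrow> A \<subseteq> B \<or> B \<subseteq> A \<or> A \<inter> B = {} \<or> V \<subseteq> A \<union> B"
    and finite_separating: "x \<in> V \<Longrightarrow> y \<in> V \<Longrightarrow> finite {A \<in> T. x \<in> A \<and> y \<notin> A}"
begin

text \<open>These are the ultrafilters of \<open>T\<close> as a poset with complementation, as in
  the duality with cube complexes; nestedness makes the complex a tree.\<close>

definition orientation :: "'v set set \<Rightarrow> bool" where
  "orientation \<sigma> \<longleftrightarrow> \<sigma> \<subseteq> T \<and> (\<forall>A\<in>T. A \<in> \<sigma> \<longleftrightarrow> V - A \<notin> \<sigma>) \<and> (\<forall>A\<in>\<sigma>. \<forall>B\<in>T. A \<subseteq> B \<longrightarrow> B \<in> \<sigma>)"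

definition principal :: "'v \<Rightarrow> 'v set set" where
  "principal x = {A \<in> T. x \<in> A}"

text \<open>The finiteness condition cuts out one connected component of the graph of all orientations;
  it contains the principal ones.\<close>

definition nodes :: "'v set set set" where
  "nodes = {\<sigma>. orientation \<sigma> \<and> (\<forall>x\<in>V. finite (\<sigma> - principal x))}"

text \<open>The formula is symmetric despite its form: \<open>\<sigma> - \<tau> = {A}\<close> forces
  \<open>\<tau> - \<sigma> = {V - A}\<close> by \<open>orientation_Diff\<close>.\<close>

definition arcs :: "'v set set set set" where
  "arcs = {{\<sigma>, \<tau>} | \<sigma> \<tau> A. \<sigma> \<in> nodes \<and> \<tau> \<in> nodes \<and> \<sigma> - \<tau> = {A}}"

definition minimal_in :: "'v set \<Rightarrow> 'v set set \<Rightarrow> bool" where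
  "minimal_in A \<sigma> \<longleftrightarrow> A \<in> \<sigma> \<and> (\<forall>B\<in>\<sigma>. B \<subseteq> A \<longrightarrow> B = A)"

lemma nodes_orientation: "\<sigma> \<in> nodes \<Longrightarrow> orientation \<sigma>"
  unfolding nodes_def by blast

lemma orientation_subset: "orientation \<sigma> \<Longrightarrow> \<sigma> \<subseteq> T"
  unfolding orientation_def by blast

lemma orientation_compl: "orientation \<sigma> \<Longrightarrow> A \<in> T \<Longrightarrow> V - A \<in> \<sigma> \<longleftrightarrow> A \<notin> \<sigma>"
  unfolding orientation_def by blast

lemma orientation_upward: "orientation \<sigma> \<Longrightarrow> A \<in> \<sigma> \<Longrightarrow> B \<in> T \<Longrightarrow> A \<subseteq> B \<Longrightarrow> B \<in> \<sigma>"
  unfolding orientation_def by blast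

lemma compl_compl: "A \<in> T \<Longrightarrow> V - (V - A) = A"
  using subset by blast

lemma orientation_Diff:
  assumes "orientation \<sigma>" "orientation \<tau>"
  shows "\<tau> - \<sigma> = (\<lambda>A. V - A) ` (\<sigma> - \<tau>)"
proof (intro equalityI subsetI)
  fix A assume A: "A \<in> \<tau> - \<sigma>"
  then have T: "A \<in> T" using orientation_subset[OF assms(2)] by blast
  then have "V - A \<in> \<sigma> - \<tau>" using A orientation_compl assms by blast
  then show "A \<in> (\<lambda>A. V - A) ` (\<sigma> - \<tau>)" using compl_compl[OF T] by (metis imageI)
next
  fix B assume "B \<in> (\<lambda>A. V - A) ` (\<sigma> - \<tau>)"
  then obtain A where A: "B = V - A" "A \<in> \<sigma>" "A \<notin> \<tau>" by blast
  then have "A \<in> T" using orientation_subset[OF assms(1)] by blast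
  then show "B \<in> \<tau> - \<sigma>" using A orientation_compl assms by blast
qed

lemma principal_node:
  assumes "x \<in> V"
  shows "principal x \<in> nodes"
proof -
  have "orientation (principal x)"
    unfolding orientation_def principal_def using assms compl by auto
  moreover have "principal x - principal y = {A \<in> T. x \<in> A \<and> y \<notin> A}" for y
    unfolding principal_def by blast
  ultimately show ?thesis unfolding nodes_def using finite_separating assms by simp
qed

lemma finite_node_Diff:
  assumes "\<sigma> \<in> nodes" "\<tau> \<in> nodes"
  shows "finite (\<sigma> - \<tau>)"
proof -
  obtain x where x: "x \<in> V" using V_nonempty by blast
  have "finite (principal x - \<tau>)"
  proof -
    have "finite (\<tau> - principal x)" using assms(2) x unfolding nodes_def by blast
    then show ?thesis
      using orientation_Diff[of \<tau> "principal x"] nodes_orientation[OF assms(2)]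
        nodes_orientation[OF principal_node[OF x]] by simp
  qed
  moreover have "finite (\<sigma> - principal x)" using assms(1) x unfolding nodes_def by blast
  ultimately have "finite ((\<sigma> - principal x) \<union> (principal x - \<tau>))" by simp
  moreover have "\<sigma> - \<tau> \<subseteq> (\<sigma> - principal x) \<union> (principal x - \<tau>)" by auto
  ultimately show ?thesis using finite_subset by blast
qed

text \<open>Minimality of \<open>A\<close> is what preserves upward closure: a set \<open>C\<close>
  strictly above \<open>V - A\<close> has its complement strictly below \<open>A\<close>, so that
  complement is not in \<open>\<sigma>\<close> and \<open>C\<close> is.\<close>

lemma flip_node:
  assumes "\<sigma> \<in> nodes" "minimal_in A \<sigma>"
  shows "insert (V - A) (\<sigma> - {A}) \<in> nodes"
proof -
  let ?\<tau> = "insert (V - A) (\<sigma> - {A})"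
  have \<sigma>: "orientation \<sigma>" using assms(1) by (rule nodes_orientation)
  have A: "A \<in> \<sigma>" "A \<in> T" "V - A \<notin> \<sigma>" "V - A \<in> T"
    and min: "\<And>B. B \<in> \<sigma> \<Longrightarrow> B \<subseteq> A \<Longrightarrow> B = A"
    using assms(2) orientation_subset[OF \<sigma>] orientation_compl[OF \<sigma>] compl
    unfolding minimal_in_def by blast+
  have "orientation ?\<tau>"
    unfolding orientation_def
  proof (intro conjI ballI impI)
    show "?\<tau> \<subseteq> T" using A orientation_subset[OF \<sigma>] by blast
  next
    fix B assume B: "B \<in> T"
    have "V - B = A \<longleftrightarrow> B = V - A" "V - B = V - A \<longleftrightarrow> B = A"
      using compl_compl[OF A(2)] compl_compl[OF B] by metis+
    then have "V - B \<in> ?\<tau> \<longleftrightarrow> B = A \<or> V - B \<in> \<sigma> \<and> B \<noteq> V - A" by simp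
    then show "B \<in> ?\<tau> \<longleftrightarrow> V - B \<notin> ?\<tau>"
      unfolding orientation_compl[OF \<sigma> B] using A(1,3) by (cases "B = A"; cases "B = V - A") simp_all
  next
    fix B C assume B: "B \<in> ?\<tau>" and C: "C \<in> T" "B \<subseteq> C"
    show "C \<in> ?\<tau>"
    proof (cases "B = V - A")
      case True
      show ?thesis
      proof (cases "C = V - A")
        case False
        have "V - C \<subseteq> A" using True C(2) by blast
        moreover have "V - C \<noteq> A" using False compl_compl[OF C(1)] by blast
        ultimately have "V - C \<notin> \<sigma>" using min by blast
        then have "C \<in> \<sigma>" using orientation_compl[OF \<sigma> C(1)] by blast
        \<comment> \<open>Otherwise \<open>V - A \<subseteq> A\<close>, which would make the member
          \<open>V - A\<close> of \<open>T\<close> empty.\<close>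
        moreover have "C \<noteq> A" using True C(2) nonempty[OF A(4)] by blast
        ultimately show ?thesis by blast
      qed simp
    next
      case False
      then have "B \<in> \<sigma>" "B \<noteq> A" using B by auto
      then show ?thesis using C orientation_upward[OF \<sigma>] min by blast
    qed
  qed
  moreover have "finite (?\<tau> - principal x)" if "x \<in> V" for x
  proof -
    have "finite (insert (V - A) (\<sigma> - principal x))"
      using assms(1) that unfolding nodes_def by simp
    moreover have "?\<tau> - principal x \<subseteq> insert (V - A) (\<sigma> - principal x)" by auto
    ultimately show ?thesis using finite_subset by blast
  qed
  ultimately show ?thesis unfolding nodes_def by blast
qed

text \<open>By nestedness a minimal \<open>A\<close> decides the side of every other cut. Hence at
  most one arc flips a given \<open>A\<close> in a given direction, which is what excludes
  cycles.\<close>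

lemma minimal_in_unique:
  assumes "orientation \<sigma>" "orientation \<tau>" "minimal_in A \<sigma>" "minimal_in A \<tau>"
  shows "\<sigma> = \<tau>"
proof -
  have "\<sigma> \<subseteq> \<tau>" if \<sigma>: "orientation \<sigma>" "minimal_in A \<sigma>" and \<tau>: "orientation \<tau>" "minimal_in A \<tau>" for \<sigma> \<tau>
  proof
    fix B assume B: "B \<in> \<sigma>"
    have A: "A \<in> \<sigma>" "A \<in> \<tau>" "A \<in> T" and BT: "B \<in> T"
      using \<sigma>(2) \<tau>(2) B orientation_subset[OF \<sigma>(1)] unfolding minimal_in_def by auto
    consider "A \<subseteq> B" | "B \<subseteq> A" | "B \<subseteq> V - A" | "V - B \<subseteq> A"
      using nested[OF A(3) BT] subset[OF BT] by blast
    then show "B \<in> \<tau>"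
    proof cases
      case 1
      then show ?thesis using orientation_upward[OF \<tau>(1) A(2) BT] by blast
    next
      case 2
      then have "B = A" using \<sigma>(2) B unfolding minimal_in_def by blast
      then show ?thesis using A(2) by blast
    next
      case 3
      then have "V - A \<in> \<sigma>" using orientation_upward[OF \<sigma>(1) B compl[OF A(3)]] by blast
      then show ?thesis using orientation_compl[OF \<sigma>(1) A(3)] A(1) by blast
    next
      case 4
      show ?thesis
      proof (rule ccontr)
        assume "B \<notin> \<tau>"
        then have "V - B \<in> \<tau>" using orientation_compl[OF \<tau>(1) BT] by blast
        then have "V - B = A" using 4 \<tau>(2) unfolding minimal_in_def by blast
        then show False using A(1) B orientation_compl[OF \<sigma>(1) BT] by blast
      qed
    qed
  qed
  then show ?thesis using assms by blast
qed

lemma arc_iff: "{\<sigma>, \<tau>} \<in> arcs \<longleftrightarrow> \<sigma> \<in> nodes \<and> \<tau> \<in> nodes \<and> (\<exists>A. \<sigma> - \<tau> = {A})"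
proof
  assume "{\<sigma>, \<tau>} \<in> arcs"
  then obtain s t A where st: "{\<sigma>, \<tau>} = {s, t}" "s \<in> nodes" "t \<in> nodes" "s - t = {A}"
    unfolding arcs_def by auto
  have "t - s = {V - A}"
    using orientation_Diff[of s t] st nodes_orientation by simp
  then show "\<sigma> \<in> nodes \<and> \<tau> \<in> nodes \<and> (\<exists>A. \<sigma> - \<tau> = {A})"
    using st by (auto simp: doubleton_eq_iff)
qed (auto simp: arcs_def)

lemma arc_flip:
  assumes "\<sigma> \<in> nodes" "\<tau> \<in> nodes" "\<sigma> - \<tau> = {A}"
  shows "minimal_in A \<sigma>" "\<tau> = insert (V - A) (\<sigma> - {A})"
proof -
  have "A \<in> T" using assms orientation_subset nodes_orientation by blast
  then show "minimal_in A \<sigma>"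
    unfolding minimal_in_def
    using assms orientation_upward[OF nodes_orientation[OF assms(2)]] by blast
  have "\<tau> - \<sigma> = {V - A}"
    using orientation_Diff[of \<sigma> \<tau>] assms nodes_orientation by simp
  then show "\<tau> = insert (V - A) (\<sigma> - {A})" using assms(3) by blast
qed

text \<open>Two nodes differ in finitely many cuts, and these can be flipped one at a time if each
  flip takes a minimal element of what remains of \<open>\<sigma> - \<tau>\<close>.\<close>

lemma nodes_connected: "graph_connected nodes arcs"
proof -
  have "\<exists>xs. graph_walk nodes arcs xs \<and> hd xs = \<sigma> \<and> last xs = \<tau>"
    if "\<sigma> \<in> nodes" "\<tau> \<in> nodes" for \<sigma> \<tau>
    using that
  proof (induction "card (\<sigma> - \<tau>)" arbitrary: \<sigma>)
    case 0
    have "\<sigma> - \<tau> = {}" using 0 finite_node_Diff by simp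
    then have "\<sigma> = \<tau>" using orientation_Diff[of \<sigma> \<tau>] 0 nodes_orientation by blast
    then show ?case using 0 by (intro exI[of _ "[\<sigma>]"]) (simp add: graph_walk_def)
  next
    case (Suc n)
    have o: "orientation \<sigma>" "orientation \<tau>" using Suc nodes_orientation by auto
    have fin: "finite (\<sigma> - \<tau>)" using Suc finite_node_Diff by blast
    moreover have "\<sigma> - \<tau> \<noteq> {}"
    proof
      assume "\<sigma> - \<tau> = {}"
      then have "card (\<sigma> - \<tau>) = 0" by (simp only: card.empty)
      then show False using Suc.hyps(2) by simp
    qed
    ultimately obtain A where A: "A \<in> \<sigma> - \<tau>" "\<And>B. B \<in> \<sigma> - \<tau> \<Longrightarrow> B \<subseteq> A \<Longrightarrow> A = B"
      using finite_has_minimal[of "\<sigma> - \<tau>"] by auto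
    have AT: "A \<in> T" using A(1) orientation_subset[OF o(1)] by blast
    \<comment> \<open>Minimality in \<open>\<sigma> - \<tau>\<close> extends to all of
      \<open>\<sigma>\<close>: a member of \<open>\<tau>\<close> below \<open>A\<close> would put
      \<open>A\<close> into \<open>\<tau>\<close>.\<close>
    have min: "minimal_in A \<sigma>"
      unfolding minimal_in_def using A orientation_upward[OF o(2) _ AT] by blast
    let ?\<sigma> = "insert (V - A) (\<sigma> - {A})"
    have node: "?\<sigma> \<in> nodes" by (rule flip_node[OF Suc.prems(1) min])
    have nin: "V - A \<notin> \<sigma>" "V - A \<in> \<tau>"
      using A(1) AT orientation_compl[OF o(1)] orientation_compl[OF o(2)] by auto
    have "\<sigma> - {A} - \<tau> = \<sigma> - \<tau> - {A}" by blast
    then have "?\<sigma> - \<tau> = \<sigma> - \<tau> - {A}" using nin(2) by (simp add: insert_Diff_if)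
    then have "n = card (?\<sigma> - \<tau>)" using Suc.hyps(2) A(1) fin by simp
    from Suc.hyps(1)[OF this node Suc.prems(2)]
    obtain xs where xs: "graph_walk nodes arcs xs" "hd xs = ?\<sigma>" "last xs = \<tau>" by blast
    have "V - A \<noteq> A" using nin A by auto
    then have "\<sigma> - ?\<sigma> = {A}" using A(1) by auto
    then have "{\<sigma>, ?\<sigma>} \<in> arcs" unfolding arc_iff using Suc.prems node by blast
    then have "graph_walk nodes arcs (\<sigma> # xs)"
      using xs Suc.prems unfolding graph_walk_def by (cases xs) auto
    then show ?case using xs by (intro exI[of _ "\<sigma> # xs"]) (auto simp: graph_walk_def)
  qed
  moreover have "nodes \<noteq> {}" using V_nonempty principal_node by blast
  ultimately show ?thesis unfolding graph_connected_def by blast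
qed

text \<open>Along a cycle, the set \<open>A\<close> flipped by the closing arc is flipped back by another arc, but
  only one arc flips \<open>A\<close>.\<close>

lemma no_cycle: "\<not> graph_cycle nodes arcs xs"
proof
  assume cyc: "graph_cycle nodes arcs xs"
  then have ne: "xs \<noteq> []" and len: "3 \<le> length xs" and dist: "distinct xs"
    and closing: "{last xs, hd xs} \<in> arcs"
    and step: "\<And>i. Suc i < length xs \<Longrightarrow> {xs ! i, xs ! Suc i} \<in> arcs"
    unfolding graph_cycle_def graph_walk_def by (auto simp: successively_conv_nth)
  obtain A where A: "last xs - hd xs = {A}" using closing unfolding arc_iff by blast
  have "A \<in> xs ! (length xs - 1)" "A \<notin> xs ! 0"
    using A ne by (auto simp: last_conv_nth hd_conv_nth)
  then obtain k where k: "k < length xs - 1" "A \<notin> xs ! k" "A \<in> xs ! Suc k"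
    using ex_least_nat_less[of "\<lambda>j. A \<in> xs ! j" "length xs - 1"] by blast
  have "{xs ! Suc k, xs ! k} \<in> arcs" using step[of k] k(1) by (simp add: insert_commute)
  then have arc: "xs ! Suc k \<in> nodes" "xs ! k \<in> nodes" "xs ! Suc k - xs ! k = {A}"
    using k unfolding arc_iff by blast+
  have last: "last xs \<in> nodes" "hd xs \<in> nodes" using closing unfolding arc_iff by auto
  have "xs ! Suc k = last xs"
    using minimal_in_unique arc_flip(1)[OF arc] arc_flip(1)[OF last A] arc(1) last(1)
      nodes_orientation by blast
  moreover from this have "xs ! k = hd xs"
    using arc_flip(2)[OF arc] arc_flip(2)[OF last A] by simp
  ultimately have "Suc k = length xs - 1" "k = 0"
    using dist k(1) ne by (simp_all add: last_conv_nth hd_conv_nth nth_eq_iff_index_eq)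
  then show False using len by simp
qed

lemma tree: "simplicial_tree nodes arcs"
proof -
  have "simple_graph nodes arcs"
    unfolding simple_graph_def
  proof
    fix e assume e: "e \<in> arcs"
    then obtain \<sigma> \<tau> A where "e = {\<sigma>, \<tau>}" "\<sigma> - \<tau> = {A}" "\<sigma> \<in> nodes" "\<tau> \<in> nodes"
      unfolding arcs_def by blast
    then show "e \<subseteq> nodes \<and> card e = 2" by (auto simp: card_2_iff)
  qed
  then show ?thesis unfolding simplicial_tree_def using nodes_connected no_cycle by blast
qed

end

section \<open>Left translates of sets of group elements\<close>

definition translate :: "('a, 'm) monoid_scheme \<Rightarrow> 'a \<Rightarrow> 'a set \<Rightarrow> 'a set" where
  "translate G g A = (\<lambda>x. g \<otimes>\<^bsub>G\<^esub> x) ` A"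

context group
begin

lemma translate_mult:
  assumes "g \<in> carrier G" "h \<in> carrier G" "A \<subseteq> carrier G"
  shows "translate G g (translate G h A) = translate G (g \<otimes> h) A"
  unfolding translate_def image_image
  by (rule image_cong[OF refl]) (use assms m_assoc in auto)

lemma translate_one: "A \<subseteq> carrier G \<Longrightarrow> translate G \<one> A = A"
  unfolding translate_def by (force simp: subset_iff)

lemma translate_subset: "g \<in> carrier G \<Longrightarrow> A \<subseteq> carrier G \<Longrightarrow> translate G g A \<subseteq> carrier G"
  unfolding translate_def by auto

lemma mem_translate:
  assumes "g \<in> carrier G" "A \<subseteq> carrier G" "x \<in> carrier G"
  shows "x \<in> translate G g A \<longleftrightarrow> inv g \<otimes> x \<in> A"
proof
  assume "x \<in> translate G g A"
  then obtain y where "y \<in> A" "x = g \<otimes> y" unfolding translate_def by blast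
  then show "inv g \<otimes> x \<in> A" using assms by (simp add: subset_iff m_assoc[symmetric])
next
  assume "inv g \<otimes> x \<in> A"
  moreover have "x = g \<otimes> (inv g \<otimes> x)" using assms by (simp add: m_assoc[symmetric])
  ultimately show "x \<in> translate G g A" unfolding translate_def by blast
qed

lemma translate_inv_translate:
  assumes "g \<in> carrier G" "A \<subseteq> carrier G"
  shows "translate G (inv g) (translate G g A) = A" "translate G g (translate G (inv g) A) = A"
  using assms by (simp_all add: translate_mult translate_one)

lemma translate_Diff:
  assumes "g \<in> carrier G" "A \<subseteq> carrier G"
  shows "translate G g (carrier G - A) = carrier G - translate G g A"
proof -
  have "x \<in> translate G g (carrier G - A) \<longleftrightarrow> x \<in> carrier G - translate G g A" if "x \<in> carrier G" for x
    using mem_translate[of g "carrier G - A" x] mem_translate[of g A x] assms that by auto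
  then show ?thesis using translate_subset[of g "carrier G - A"] assms(1) by blast
qed

lemma translate_mono: "A \<subseteq> B \<Longrightarrow> translate G g A \<subseteq> translate G g B"
  unfolding translate_def by blast

end

section \<open>The induced group action on the tree\<close>

locale invariant_nested_family = group G + nested_family "carrier G" T
  for G :: "('a, 'm) monoid_scheme" (structure) and T +
  assumes invariant: "g \<in> carrier G \<Longrightarrow> A \<in> T \<Longrightarrow> translate G g A \<in> T"
    and finite_transporter: "A \<in> T \<Longrightarrow> B \<in> T \<Longrightarrow> finite {g \<in> carrier G. translate G g A = B}"
    and infinite: "A \<in> T \<Longrightarrow> infinite A"
    and T_nonempty: "T \<noteq> {}"
begin

text \<open>The restriction is there because \<open>group_action\<close> takes values in
  \<open>Bij nodes\<close>, whose members are extensional.\<close>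

definition act :: "'a \<Rightarrow> 'a set set \<Rightarrow> 'a set set" where
  "act g = restrict (\<lambda>\<sigma>. translate G g ` \<sigma>) nodes"

lemma node_sub: "\<sigma> \<in> nodes \<Longrightarrow> \<sigma> \<subseteq> T"
  using nodes_orientation orientation_subset by blast

lemma act_eq: "\<sigma> \<in> nodes \<Longrightarrow> act g \<sigma> = translate G g ` \<sigma>"
  unfolding act_def by simp

lemma mem_image_translate:
  assumes "g \<in> carrier G" "\<sigma> \<subseteq> T" "A \<in> T"
  shows "A \<in> translate G g ` \<sigma> \<longleftrightarrow> translate G (inv g) A \<in> \<sigma>"
proof
  assume "A \<in> translate G g ` \<sigma>"
  then obtain B where "B \<in> \<sigma>" "A = translate G g B" by blast
  moreover from this have "B \<subseteq> carrier G" using assms(2) subset by blast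
  ultimately show "translate G (inv g) A \<in> \<sigma>"
    using translate_inv_translate(1)[OF assms(1)] by simp
next
  assume "translate G (inv g) A \<in> \<sigma>"
  then show "A \<in> translate G g ` \<sigma>"
    using translate_inv_translate(2)[OF assms(1) subset[OF assms(3)]] by (metis imageI)
qed

lemma image_translate_node:
  assumes g: "g \<in> carrier G" and \<sigma>: "\<sigma> \<in> nodes"
  shows "translate G g ` \<sigma> \<in> nodes"
proof -
  note o = nodes_orientation[OF \<sigma>]
  note mem = mem_image_translate[OF g node_sub[OF \<sigma>]]
  have g': "inv g \<in> carrier G" using g by simp
  have sub: "translate G g ` \<sigma> \<subseteq> T" using invariant[OF g] node_sub[OF \<sigma>] by blast
  have "orientation (translate G g ` \<sigma>)"
    unfolding orientation_def
  proof (intro conjI ballI impI sub)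
    fix A assume A: "A \<in> T"
    show "A \<in> translate G g ` \<sigma> \<longleftrightarrow> carrier G - A \<notin> translate G g ` \<sigma>"
      unfolding mem[OF A] mem[OF compl[OF A]] translate_Diff[OF g' subset[OF A]]
      using orientation_compl[OF o invariant[OF g' A]] by simp
  next
    fix A B assume A: "A \<in> translate G g ` \<sigma>" and B: "B \<in> T" "A \<subseteq> B"
    have "translate G (inv g) A \<in> \<sigma>" using A sub mem by blast
    then show "B \<in> translate G g ` \<sigma>"
      unfolding mem[OF B(1)]
      using orientation_upward[OF o _ invariant[OF g' B(1)] translate_mono[OF B(2)]] by blast
  qed
  moreover have "finite (translate G g ` \<sigma> - principal x)" if x: "x \<in> carrier G" for x
  proof -
    \<comment> \<open>Translating by \<open>g\<close> turns the question whether a set contains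
      \<open>inv g \<otimes> x\<close> into the question whether its translate contains
      \<open>x\<close>. The deviation from one principal orientation is thus carried to the
      deviation from another.\<close>
    have "translate G g ` \<sigma> - principal x \<subseteq> translate G g ` (\<sigma> - principal (inv g \<otimes> x))"
    proof
      fix B assume "B \<in> translate G g ` \<sigma> - principal x"
      then obtain A where A: "A \<in> \<sigma>" "B = translate G g A" "B \<notin> principal x" by blast
      have "A \<in> T" using A(1) node_sub[OF \<sigma>] by blast
      then have "A \<notin> principal (inv g \<otimes> x)"
        using A(2,3) mem_translate[OF g subset x] invariant[OF g] unfolding principal_def by auto
      then show "B \<in> translate G g ` (\<sigma> - principal (inv g \<otimes> x))" using A by blast
    qed
    moreover have "finite (\<sigma> - principal (inv g \<otimes> x))"
      using \<sigma> g x unfolding nodes_def by simp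
    ultimately show ?thesis by (meson finite_imageI finite_subset)
  qed
  ultimately show ?thesis unfolding nodes_def by blast
qed

lemma image_translate_mult:
  assumes "g \<in> carrier G" "h \<in> carrier G" "\<sigma> \<in> nodes"
  shows "translate G g ` translate G h ` \<sigma> = translate G (g \<otimes> h) ` \<sigma>"
  unfolding image_image
proof (rule image_cong[OF refl])
  fix A assume "A \<in> \<sigma>"
  then have "A \<subseteq> carrier G" using node_sub[OF assms(3)] subset by blast
  then show "translate G g (translate G h A) = translate G (g \<otimes> h) A"
    by (rule translate_mult[OF assms(1,2)])
qed

lemma image_translate_one:
  assumes "\<sigma> \<in> nodes"
  shows "translate G \<one> ` \<sigma> = \<sigma>"
proof -
  have "translate G \<one> A = A" if "A \<in> \<sigma>" for A
    using that translate_one node_sub[OF assms] subset by blast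
  then show ?thesis by simp
qed

lemma act_Bij: "g \<in> carrier G \<Longrightarrow> act g \<in> Bij nodes"
proof -
  assume g: "g \<in> carrier G"
  have "bij_betw (act g) nodes nodes"
    by (rule bij_betw_byWitness[where f' = "\<lambda>\<sigma>. translate G (inv g) ` \<sigma>"])
      (use g in \<open>auto simp: act_eq image_translate_node image_translate_mult image_translate_one\<close>)
  then show ?thesis unfolding Bij_def act_def by simp
qed

lemma group_action_act: "group_action G nodes act"
proof -
  have "act (g \<otimes> h) = compose nodes (act g) (act h)" if "g \<in> carrier G" "h \<in> carrier G" for g h
  proof
    fix \<sigma>
    show "act (g \<otimes> h) \<sigma> = compose nodes (act g) (act h) \<sigma>"
      using that by (cases "\<sigma> \<in> nodes")
        (simp_all add: compose_def act_def image_translate_node image_translate_mult)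
  qed
  then have "act \<in> hom G (BijGroup nodes)"
    by (intro homI) (auto simp: BijGroup_def act_Bij)
  then show ?thesis
    unfolding group_action_def group_hom_def group_hom_axioms_def
    using group_BijGroup is_group by blast
qed

lemma translate_inj_on: "g \<in> carrier G \<Longrightarrow> inj_on (translate G g) T"
  by (rule inj_on_inverseI[of _ "translate G (inv g)"])
    (simp add: translate_inv_translate(1) subset)

lemma act_Diff:
  assumes "g \<in> carrier G" "\<sigma> \<in> nodes" "\<tau> \<in> nodes"
  shows "act g \<sigma> - act g \<tau> = translate G g ` (\<sigma> - \<tau>)"
proof -
  have "\<sigma> - \<tau> \<subseteq> T" "\<tau> \<subseteq> T" using assms node_sub by auto
  then show ?thesis
    using inj_on_image_set_diff[OF translate_inj_on[OF assms(1)]] assms by (simp add: act_eq)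
qed

lemma act_in_nodes: "g \<in> carrier G \<Longrightarrow> \<sigma> \<in> nodes \<Longrightarrow> act g \<sigma> \<in> nodes"
  by (simp add: act_eq image_translate_node)

lemma graph_action_act: "graph_action G nodes arcs act"
  unfolding graph_action_def
proof (intro conjI group_action_act ballI)
  fix g e assume g: "g \<in> carrier G" and "e \<in> arcs"
  then obtain \<sigma> \<tau> A where e: "e = {\<sigma>, \<tau>}" "\<sigma> \<in> nodes" "\<tau> \<in> nodes" "\<sigma> - \<tau> = {A}"
    unfolding arcs_def by blast
  have "act g \<sigma> - act g \<tau> = {translate G g A}" using act_Diff[OF g e(2,3)] e(4) by simp
  then have "{act g \<sigma>, act g \<tau>} \<in> arcs"
    unfolding arc_iff using act_in_nodes g e by blast
  then show "act g ` e \<in> arcs" unfolding e(1) by simp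
qed

text \<open>An element that preserves the edge either fixes its ends, and then fixes
  \<open>A\<close>, or swaps them, and then carries \<open>A\<close> to its complement. Both cases
  are transporters between members of \<open>T\<close>.\<close>

lemma finite_edge_stabilizer:
  assumes "e \<in> arcs"
  shows "finite (edge_stabilizer G act e)"
proof -
  obtain \<sigma> \<tau> A where e: "e = {\<sigma>, \<tau>}" "\<sigma> \<in> nodes" "\<tau> \<in> nodes" "\<sigma> - \<tau> = {A}"
    using assms unfolding arcs_def by blast
  have A: "A \<in> T" using e node_sub by blast
  have compl': "\<tau> - \<sigma> = {carrier G - A}"
    using orientation_Diff[of \<sigma> \<tau>] e nodes_orientation by simp
  have "edge_stabilizer G act e \<subseteq> {g \<in> carrier G. translate G g A = A}
      \<union> {g \<in> carrier G. translate G g A = carrier G - A}"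
  proof
    fix g assume "g \<in> edge_stabilizer G act e"
    then have g: "g \<in> carrier G" "{act g \<sigma>, act g \<tau>} = {\<sigma>, \<tau>}"
      unfolding edge_stabilizer_def stabilizer_def e(1) by auto
    have "act g \<sigma> - act g \<tau> = {translate G g A}" using act_Diff[OF g(1) e(2,3)] e(4) by simp
    moreover have "act g \<sigma> - act g \<tau> = {A} \<or> act g \<sigma> - act g \<tau> = {carrier G - A}"
    proof -
      have "act g \<sigma> = \<sigma> \<and> act g \<tau> = \<tau> \<or> act g \<sigma> = \<tau> \<and> act g \<tau> = \<sigma>"
        using g(2) by (simp add: doubleton_eq_iff)
      then show ?thesis using e(4) compl' by (elim disjE conjE) simp_all
    qed
    ultimately show "g \<in> {g \<in> carrier G. translate G g A = A}
        \<union> {g \<in> carrier G. translate G g A = carrier G - A}"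
      using g(1) by auto
  qed
  then show ?thesis
    using finite_transporter[OF A A] finite_transporter[OF A compl[OF A]]
    by (meson finite_UnI finite_subset)
qed

text \<open>A fixed orientation through \<open>A\<close> contains all translates of \<open>A\<close>. Infinitely many of these
  avoid \<open>\<one>\<close>, but a node differs from \<open>principal \<one>\<close> by finitely many sets only.\<close>

lemma no_fixed_node:
  assumes \<sigma>: "\<sigma> \<in> nodes"
  shows "\<exists>g\<in>carrier G. act g \<sigma> \<noteq> \<sigma>"
proof (rule ccontr)
  assume "\<not> (\<exists>g\<in>carrier G. act g \<sigma> \<noteq> \<sigma>)"
  then have fixed: "translate G g ` \<sigma> = \<sigma>" if "g \<in> carrier G" for g
    using that \<sigma> by (auto simp: act_eq)
  obtain B where B: "B \<in> T" using T_nonempty by blast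
  then have "\<exists>A. A \<in> \<sigma>"
    using orientation_compl[OF nodes_orientation[OF \<sigma>] B] by blast
  then obtain A where A: "A \<in> \<sigma>" by blast
  then have AT: "A \<in> T" using node_sub[OF \<sigma>] by blast
  \<comment> \<open>The inverses are taken because \<open>\<one>\<close> lies in
    \<open>translate G (inv x) A\<close> exactly when \<open>x\<close> lies in
    \<open>A\<close>.\<close>
  define M where "M = (\<lambda>x. inv x) ` (carrier G - A)"
  have "infinite M"
    unfolding M_def using infinite[OF compl[OF AT]] finite_imageD inv_inj
    by (metis Diff_subset inj_on_subset)
  moreover have "(\<lambda>g. translate G g A) ` M \<subseteq> \<sigma> - principal \<one>"
  proof
    fix C assume "C \<in> (\<lambda>g. translate G g A) ` M"
    then obtain x where x: "x \<in> carrier G" "x \<notin> A" "C = translate G (inv x) A"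
      unfolding M_def by blast
    have "\<one> \<notin> C" using x mem_translate[of "inv x" A \<one>] subset[OF AT] by simp
    moreover have "C \<in> \<sigma>" using fixed[of "inv x"] x A by auto
    ultimately show "C \<in> \<sigma> - principal \<one>" unfolding principal_def by simp
  qed
  moreover have "finite (\<sigma> - principal \<one>)" using \<sigma> unfolding nodes_def by simp
  \<comment> \<open>Infinitely many elements of \<open>M\<close> yield only finitely many
    translates, so one translate arises infinitely often, against
    \<open>finite_transporter\<close>.\<close>
  ultimately obtain h where h: "h \<in> M" "\<not> finite {g \<in> M. translate G g A = translate G h A}"
    using pigeonhole_infinite[of M "\<lambda>g. translate G g A"] by (meson finite_subset)
  have M: "M \<subseteq> carrier G" unfolding M_def by auto
  then have "finite {g \<in> carrier G. translate G g A = translate G h A}"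
    using finite_transporter[OF AT invariant[OF _ AT]] h(1) by blast
  moreover have "{g \<in> M. translate G g A = translate G h A}
      \<subseteq> {g \<in> carrier G. translate G g A = translate G h A}" using M by blast
  ultimately show False using h(2) finite_subset by blast
qed

lemma nontrivial_act: "nontrivial_action G nodes arcs act"
  unfolding nontrivial_action_def
proof
  assume "\<exists>p\<in>geo_points nodes arcs. \<forall>g\<in>carrier G. geo_map (act g) p = p"
  then obtain p where p: "geo_supp p \<in> geo_simplices nodes arcs" "\<forall>v. 0 \<le> p v"
    and fixed: "\<And>g. g \<in> carrier G \<Longrightarrow> geo_map (act g) p = p"
    unfolding geo_points_def by blast
  have "finite (geo_supp p)" using p(1) unfolding geo_simplices_def arcs_def by auto
  then have inv: "act g ` geo_supp p = geo_supp p" if "g \<in> carrier G" for g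
    using geo_supp_geo_map[of p "act g"] fixed[OF that] p(2) by simp
  consider \<sigma> where "\<sigma> \<in> nodes" "geo_supp p = {\<sigma>}" | "geo_supp p \<in> arcs"
    using p(1) unfolding geo_simplices_def by blast
  then show False
  proof cases
    case 1
    then have "act g \<sigma> = \<sigma>" if "g \<in> carrier G" for g using inv[OF that] by simp
    then show False using no_fixed_node[OF 1(1)] by blast
  next
    case 2
    have "edge_stabilizer G act (geo_supp p) = carrier G"
      unfolding edge_stabilizer_def stabilizer_def using inv by blast
    then have "finite (carrier G)" using finite_edge_stabilizer[OF 2] by simp
    then show False using T_nonempty infinite subset finite_subset by blast
  qed
qed

end

section \<open>From unbounded components to cuts\<close>

definition vertex_point :: "'v \<Rightarrow> 'v \<Rightarrow> real" where
  "vertex_point v = (\<lambda>w. if w = v then 1 else 0)"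

lemma geo_supp_vertex_point: "geo_supp (vertex_point v) = {v}"
  unfolding geo_supp_def vertex_point_def by simp

lemma vertex_point_in_geo_points: "v \<in> V \<Longrightarrow> vertex_point v \<in> geo_points V E"
  unfolding geo_points_def geo_simplices_def by (simp add: geo_supp_vertex_point) (simp add: vertex_point_def)

lemma edge_point_0: "edge_point u v 0 = vertex_point u"
  unfolding edge_point_def vertex_point_def by auto

lemma edge_point_1: "u \<noteq> v \<Longrightarrow> edge_point u v 1 = vertex_point v"
  unfolding edge_point_def vertex_point_def by auto

lemma geo_supp_edge_point: "geo_supp (edge_point u v t) \<subseteq> {u, v}"
  unfolding geo_supp_def edge_point_def by auto

lemma simple_graph_edgeE:
  assumes "simple_graph V E" "e \<in> E"
  obtains u v where "e = {u, v}" "u \<noteq> v" "u \<in> V" "v \<in> V"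
  using assms unfolding simple_graph_def by (metis card_2_iff insert_subset)

lemma geo_points_supp:
  assumes "simple_graph V E" "p \<in> geo_points V E"
  shows "geo_supp p \<subseteq> V" "geo_supp p \<noteq> {}" "finite (geo_supp p)"
proof -
  have "geo_supp p \<in> geo_simplices V E" "(\<Sum>v\<in>geo_supp p. p v) = 1"
    using assms(2) unfolding geo_points_def by auto
  then show "geo_supp p \<noteq> {}" by auto
  have "e \<subseteq> V \<and> finite e" if "e \<in> geo_simplices V E" for e
    using that simple_graph_edgeE[OF assms(1)] unfolding geo_simplices_def
    by (elim UnE) (blast, metis empty_subsetI finite.simps insert_subset)
  then show "geo_supp p \<subseteq> V" "finite (geo_supp p)"
    using \<open>geo_supp p \<in> geo_simplices V E\<close> by auto
qed

lemma geo_points_le_1: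
  assumes "simple_graph V E" "p \<in> geo_points V E"
  shows "p v \<le> 1"
proof (cases "v \<in> geo_supp p")
  case True
  have "p v \<le> (\<Sum>w\<in>geo_supp p. p w)"
    using True assms geo_points_supp(3)[OF assms]
    by (intro member_le_sum) (auto simp: geo_points_def)
  then show ?thesis using assms(2) unfolding geo_points_def by simp
qed (simp add: geo_supp_def)

lemma geo_points_cases:
  assumes "simple_graph V E" "p \<in> geo_points V E"
  obtains v where "v \<in> V" "p = vertex_point v"
  | u v t where "{u, v} \<in> E" "u \<noteq> v" "t \<in> {0..1}" "p = edge_point u v t" "geo_supp p = {u, v}"
proof -
  have p: "geo_supp p \<in> geo_simplices V E" "\<And>v. 0 \<le> p v" "(\<Sum>v\<in>geo_supp p. p v) = 1"
    using assms(2) unfolding geo_points_def by auto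
  have zero: "p w = 0" if "w \<notin> geo_supp p" for w using that unfolding geo_supp_def by simp
  consider v where "v \<in> V" "geo_supp p = {v}" | "geo_supp p \<in> E"
    using p(1) unfolding geo_simplices_def by blast
  then show thesis
  proof cases
    case 1
    then have "p = vertex_point v"
      using p(3) zero unfolding vertex_point_def by (intro ext) auto
    then show ?thesis using that(1) 1(1) by blast
  next
    case 2
    then obtain u v where uv: "geo_supp p = {u, v}" "u \<noteq> v"
      using simple_graph_edgeE[OF assms(1)] by metis
    then have sum: "p u + p v = 1" using p(3) by simp
    then have "p = edge_point u v (p v)"
      using zero uv unfolding edge_point_def by (intro ext) auto
    moreover have "p v \<in> {0..1}" using sum p(2)[of u] p(2)[of v] by simp
    ultimately show ?thesis using that(2) 2 uv by metis
  qed
qed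

text \<open>The 2 absorbs the partial edges from \<open>p\<close> to \<open>u\<close> and from
  \<open>v\<close> to \<open>q\<close>, each of length at most 1. The work lies in showing the set
  bounded below, as \<open>Inf\<close> requires.\<close>

lemma geo_dist_le:
  assumes "simple_graph V E" "p \<in> geo_points V E" "q \<in> geo_points V E"
    and "u \<in> geo_supp p" "v \<in> geo_supp q"
  shows "geo_dist V E p q \<le> 2 + real (graph_dist V E u v)"
proof -
  have "geo_dist V E p q \<le> (1 - p u) + real (graph_dist V E u v) + (1 - q v)"
    unfolding geo_dist_def
  proof (rule cInf_lower)
    show "bdd_below ({(1 - p u) + real (graph_dist V E u v) + (1 - q v) | u v.
          u \<in> geo_supp p \<and> v \<in> geo_supp q}
        \<union> {(\<Sum>w\<in>geo_supp p \<union> geo_supp q. \<bar>p w - q w\<bar>) / 2 | e.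
            e \<in> geo_simplices V E \<and> geo_supp p \<union> geo_supp q \<subseteq> e})"
    proof (rule bdd_belowI[of _ 0], elim UnE CollectE exE conjE)
      fix x u v assume "x = (1 - p u) + real (graph_dist V E u v) + (1 - q v)"
      then show "0 \<le> x"
        using geo_points_le_1[OF assms(1,2), of u] geo_points_le_1[OF assms(1,3), of v] by simp
    next
      fix x assume "x = (\<Sum>w\<in>geo_supp p \<union> geo_supp q. \<bar>p w - q w\<bar>) / 2"
      moreover have "0 \<le> (\<Sum>w\<in>geo_supp p \<union> geo_supp q. \<bar>p w - q w\<bar>)"
        by (intro sum_nonneg abs_ge_zero)
      ultimately show "0 \<le> x" by linarith
    qed
  qed (use assms in blast)
  also have "\<dots> \<le> 2 + real (graph_dist V E u v)"
  proof -
    have "0 \<le> p u" "0 \<le> q v" using assms(2,3) unfolding geo_points_def by auto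
    then show ?thesis by linarith
  qed
  finally show ?thesis .
qed

text \<open>Pairs from \<open>F\<close> give finitely many values of \<open>graph_dist\<close>, and
  their maximum serves as a uniform bound.\<close>

lemma geo_bounded_if_finite:
  assumes "simple_graph V E" "finite F" "C \<subseteq> geo_points V E"
    and meets: "\<And>p. p \<in> C \<Longrightarrow> geo_supp p \<inter> F \<noteq> {}"
  shows "geo_bounded V E C"
  unfolding geo_bounded_def
proof (intro exI ballI)
  let ?D = "(\<lambda>(u, v). real (graph_dist V E u v)) ` (F \<times> F)"
  fix p q assume p: "p \<in> C" and q: "q \<in> C"
  obtain u v where uv: "u \<in> geo_supp p" "u \<in> F" "v \<in> geo_supp q" "v \<in> F"
    using meets[OF p] meets[OF q] by blast
  have "real (graph_dist V E u v) \<le> Max ?D"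
    using assms(2) uv by (intro Max_ge) auto
  then show "geo_dist V E p q \<le> 2 + Max ?D"
    using geo_dist_le[of V E p q u v] assms(1,3) p q uv by force
qed

lemma continuous_map_edge_point:
  assumes "simple_graph V E" "{u, v} \<in> E"
  shows "continuous_map (top_of_set {0..1}) (geo_topology V E) (edge_point u v)"
  unfolding continuous_map_def
proof (intro conjI funcsetI allI impI)
  fix t assume "t \<in> topspace (top_of_set {0..1::real})"
  then show "edge_point u v t \<in> topspace (geo_topology V E)"
    using edge_point_in_geo_points[OF assms] topspace_geo_topology[OF assms(1)] by simp
next
  fix U assume "openin (geo_topology V E) U"
  then show "openin (top_of_set {0..1}) {t \<in> topspace (top_of_set {0..1}). edge_point u v t \<in> U}"
    using assms(2) unfolding openin_geo_topology geo_open_def by simp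
qed

lemma open_star:
  assumes "simple_graph V E"
  shows "openin (geo_topology V E) {p \<in> geo_points V E. 0 < p w}"
  unfolding openin_geo_topology geo_open_def
proof (intro conjI allI impI)
  fix u v assume e: "{u, v} \<in> E"
  have "continuous_on {0..1} (\<lambda>t. edge_point u v t w)"
    unfolding edge_point_def
    by (cases "w = u"; cases "w = v") (simp_all add: continuous_intros)
  then have "openin (top_of_set {0..1}) ({0..1} \<inter> (\<lambda>t. edge_point u v t w) -` {0<..})"
    by (rule continuous_openin_preimage_gen) simp
  moreover have "{t \<in> {0..1}. edge_point u v t \<in> {p \<in> geo_points V E. 0 < p w}}
      = {0..1} \<inter> (\<lambda>t. edge_point u v t w) -` {0<..}"
    using edge_point_in_geo_points[OF assms e] by auto
  ultimately show "openin (top_of_set {0..1})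
      {t \<in> {0..1}. edge_point u v t \<in> {p \<in> geo_points V E. 0 < p w}}" by simp
qed blast

section \<open>Components of the complement of a compact subgraph\<close>

locale compact_subgraph =
  fixes V :: "'v set" and E :: "'v set set" and V' :: "'v set" and E' :: "'v set set"
  assumes simple: "simple_graph V E"
    and subgraph: "subgraph_of V' E' V E"
    and compact: "compactin (geo_topology V E) (geo_points V' E')"
begin

abbreviation outside :: "('v \<Rightarrow> real) topology" where
  "outside \<equiv> subtopology (geo_topology V E) (topspace (geo_topology V E) - geo_points V' E')"

definition component_vertices :: "('v \<Rightarrow> real) set \<Rightarrow> 'v set" where
  "component_vertices C = {v \<in> V. vertex_point v \<in> C}"

lemma simple': "simple_graph V' E'"
  using subgraph unfolding subgraph_of_def by blast

text \<open>The open stars of the vertices in \<open>V'\<close> cover the subgraph, and the star of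
  \<open>w\<close> contains no vertex other than \<open>w\<close>. A finite subcover must therefore
  use every vertex.\<close>

lemma finite_vertices: "finite V'"
proof -
  let ?U = "\<lambda>w. {p \<in> geo_points V E. 0 < p w}"
  have sub: "geo_points V' E' \<subseteq> geo_points V E"
    using compactin_subset_topspace[OF compact] topspace_geo_topology[OF simple] by simp
  have "geo_points V' E' \<subseteq> \<Union>(?U ` V')"
  proof
    fix p assume p: "p \<in> geo_points V' E'"
    then obtain w where w: "w \<in> geo_supp p" "w \<in> V'"
      using geo_points_supp(1,2)[OF simple' p] by blast
    then have "0 < p w" using p unfolding geo_points_def geo_supp_def by (simp add: less_le)
    then show "p \<in> \<Union>(?U ` V')" using w p sub by blast
  qed
  moreover have "openin (geo_topology V E) U" if "U \<in> ?U ` V'" for U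
    using that open_star[OF simple] by blast
  ultimately obtain \<F> where F: "finite \<F>" "\<F> \<subseteq> ?U ` V'" "geo_points V' E' \<subseteq> \<Union>\<F>"
    using compact unfolding compactin_def by meson
  then obtain W where W: "W \<subseteq> V'" "finite W" "\<F> = ?U ` W"
    by (meson finite_subset_image)
  have "V' \<subseteq> W"
  proof
    fix v assume "v \<in> V'"
    then have "vertex_point v \<in> geo_points V' E'" by (rule vertex_point_in_geo_points)
    then obtain w where "w \<in> W" "vertex_point v \<in> ?U w" using F(3) W(3) by auto
    then show "v \<in> W" by (auto simp: vertex_point_def split: if_splits)
  qed
  then show ?thesis using W(2) finite_subset by blast
qed

text \<open>A closed edge is a connected image of the interval. Points of the removed subgraph have
  nonempty support in \<open>V'\<close>, so an edge with both ends outside \<open>V'\<close> avoids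
  it entirely and lies in a single component.\<close>

lemma edge_in_component:
  assumes C: "C \<in> connected_components_of outside"
    and e: "{u, v} \<in> E" "u \<notin> V'" "v \<notin> V'"
    and t: "t \<in> {0..1}" "edge_point u v t \<in> C" and s: "s \<in> {0..1}"
  shows "edge_point u v s \<in> C"
proof -
  have conn: "connectedin (geo_topology V E) (edge_point u v ` {0..1})"
    by (rule connectedin_continuous_map_image[OF continuous_map_edge_point[OF simple e(1)]])
      (simp add: connectedin_subtopology)
  have "edge_point u v r \<notin> geo_points V' E'" for r
    using geo_points_supp(1,2)[OF simple'] geo_supp_edge_point[of u v r] e(2,3) by blast
  then have "connectedin outside (edge_point u v ` {0..1})"
    using conn connectedin_subset_topspace[OF conn] unfolding connectedin_subtopology by blast
  then have "edge_point u v ` {0..1} \<subseteq> C"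
    by (rule connected_components_of_maximal[OF C]) (use t in \<open>auto simp: disjnt_iff\<close>)
  then show ?thesis using s by blast
qed

lemma boundary_component_vertices:
  assumes "C \<in> connected_components_of outside"
  shows "boundary E (component_vertices C) \<subseteq> {e \<in> E. e \<inter> V' \<noteq> {}}"
proof
  fix e assume e: "e \<in> boundary E (component_vertices C)"
  then have eE: "e \<in> E" unfolding boundary_def by blast
  obtain u v where uv: "u \<in> e" "u \<in> component_vertices C" "v \<in> e" "v \<notin> component_vertices C"
    using e unfolding boundary_def by blast
  then have ne: "u \<noteq> v" by blast
  have e_eq: "e = {u, v}" "v \<in> V"
    using simple_graph_edgeE[OF simple eE] uv(1,3) ne by (metis insertE singletonD insert_commute)+
  show "e \<in> {e \<in> E. e \<inter> V' \<noteq> {}}"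
  proof (rule ccontr)
    assume "e \<notin> {e \<in> E. e \<inter> V' \<noteq> {}}"
    then have "u \<notin> V'" "v \<notin> V'" using eE e_eq by auto
    moreover have "edge_point u v 0 \<in> C"
      using uv(2) unfolding component_vertices_def edge_point_0 by blast
    ultimately have "edge_point u v 1 \<in> C"
      using edge_in_component[OF assms, of u v 0 1] eE e_eq(1) by simp
    then show False
      using uv(4) e_eq(2) ne unfolding component_vertices_def by (simp add: edge_point_1)
  qed
qed

text \<open>A point of \<open>C\<close> on an edge with both ends outside \<open>V'\<close> drags
  these ends into \<open>C\<close>, so the support of every point of \<open>C\<close> meets
  \<open>V'\<close> or the vertices of \<open>C\<close>. If both sets were finite, \<open>C\<close>
  would be bounded.\<close>

lemma infinite_component_vertices:
  assumes C: "C \<in> connected_components_of outside" and unb: "\<not> geo_bounded V E C"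
  shows "infinite (component_vertices C)"
proof
  assume fin: "finite (component_vertices C)"
  have sub: "C \<subseteq> geo_points V E"
    using connected_components_of_subset[OF C] topspace_geo_topology[OF simple] by auto
  have "geo_supp p \<inter> (component_vertices C \<union> V') \<noteq> {}" if p: "p \<in> C" for p
  proof -
    have "p \<in> geo_points V E" using p sub by blast
    from simple this show ?thesis
    proof (cases rule: geo_points_cases)
      case (1 v)
      then show ?thesis using p by (simp add: geo_supp_vertex_point component_vertices_def)
    next
      case (2 u v t)
      have "vertex_point u \<in> C" if "u \<notin> V'" "v \<notin> V'"
        using edge_in_component[OF C 2(1) that, of t 0] 2 p by (simp add: edge_point_0)
      moreover have "u \<in> V" using bspec[OF simple[unfolded simple_graph_def] 2(1)] by simp
      ultimately show ?thesis using 2(5) unfolding component_vertices_def by blast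
    qed
  qed
  then have "geo_bounded V E C"
    using geo_bounded_if_finite[OF simple _ sub] fin finite_vertices by blast
  then show False using unb by blast
qed

lemma infinite_cut_exists:
  assumes C1: "C1 \<in> connected_components_of outside" "\<not> geo_bounded V E C1"
    and C2: "C2 \<in> connected_components_of outside" "\<not> geo_bounded V E C2"
    and ne: "C1 \<noteq> C2" and locally_finite: "\<And>v. v \<in> V \<Longrightarrow> finite {e \<in> E. v \<in> e}"
  shows "\<exists>A\<subseteq>V. infinite A \<and> infinite (V - A) \<and> finite (boundary E A)"
proof (intro exI conjI)
  let ?A = "component_vertices C1"
  show "?A \<subseteq> V" unfolding component_vertices_def by blast
  show "infinite ?A" by (rule infinite_component_vertices[OF C1])
  have "C1 \<inter> C2 = {}"
    using connected_components_of_disjoint[OF C1(1) C2(1)] ne by (simp add: disjnt_def)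
  then have "component_vertices C2 \<subseteq> V - ?A" unfolding component_vertices_def by blast
  then show "infinite (V - ?A)"
    using infinite_component_vertices[OF C2] finite_subset by blast
  have "{e \<in> E. e \<inter> V' \<noteq> {}} = (\<Union>v\<in>V'. {e \<in> E. v \<in> e})" by blast
  moreover have "V' \<subseteq> V" using subgraph unfolding subgraph_of_def by blast
  ultimately have "finite {e \<in> E. e \<inter> V' \<noteq> {}}"
    using finite_vertices locally_finite by auto
  then show "finite (boundary E ?A)"
    using boundary_component_vertices[OF C1(1)] finite_subset by blast
qed

end

section \<open>Groups acting on their Cayley graphs\<close>

locale multi_ended_group_graph = group G + multi_ended_graph "carrier G" E
  for G :: "('a, 'm) monoid_scheme" (structure) and E +
  assumes edge_translate: "g \<in> carrier G \<Longrightarrow> e \<in> E \<Longrightarrow> translate G g e \<in> E"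
begin

lemma inj_translate: "g \<in> carrier G \<Longrightarrow> inj_on (translate G g) (Pow (carrier G))"
  by (rule inj_on_inverseI[of _ "translate G (inv g)"]) (simp add: translate_inv_translate(1))

lemma infinite_translate:
  assumes "g \<in> carrier G" "A \<subseteq> carrier G" "infinite A"
  shows "infinite (translate G g A)"
proof
  assume "finite (translate G g A)"
  then have "finite (translate G (inv g) (translate G g A))" unfolding translate_def by simp
  then show False using assms translate_inv_translate(1) by simp
qed

lemma translate_in_boundary:
  assumes g: "g \<in> carrier G" and A: "A \<subseteq> carrier G" and e: "e \<in> boundary E A"
  shows "translate G g e \<in> boundary E (translate G g A)"
proof -
  have E: "e \<in> E" "e \<subseteq> carrier G" using e edges_subset unfolding boundary_def by auto
  obtain x where x: "x \<in> e" "x \<notin> A" using e unfolding boundary_def by blast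
  then have "g \<otimes> x \<notin> translate G g A"
    using mem_translate[OF g A, of "g \<otimes> x"] g E(2) by (auto simp: m_assoc[symmetric])
  then have "\<not> translate G g e \<subseteq> translate G g A" using x(1) unfolding translate_def by blast
  moreover have "translate G g e \<inter> translate G g A \<noteq> {}"
    using e unfolding boundary_def translate_def by blast
  ultimately show ?thesis using edge_translate[OF g E(1)] unfolding boundary_def by blast
qed

lemma boundary_translate:
  assumes g: "g \<in> carrier G" and A: "A \<subseteq> carrier G"
  shows "boundary E (translate G g A) = translate G g ` boundary E A"
proof
  show "translate G g ` boundary E A \<subseteq> boundary E (translate G g A)"
    using translate_in_boundary[OF g A] by blast
  show "boundary E (translate G g A) \<subseteq> translate G g ` boundary E A"
  proof
    fix e assume e: "e \<in> boundary E (translate G g A)"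
    then have sub: "e \<subseteq> carrier G" using edges_subset unfolding boundary_def by auto
    have "translate G (inv g) e \<in> boundary E A"
      using translate_in_boundary[of "inv g", OF _ translate_subset[OF g A] e] g A
      by (simp add: translate_inv_translate)
    then show "e \<in> translate G g ` boundary E A"
      using translate_inv_translate(2)[OF g sub] by (metis imageI)
  qed
qed

lemma min_cut_translate:
  assumes g: "g \<in> carrier G" and A: "min_cut A"
  shows "min_cut (translate G g A)"
proof -
  have c: "A \<subseteq> carrier G" "infinite A" "infinite (carrier G - A)" "finite (boundary E A)"
    using A unfolding min_cut_def cut_def by auto
  have "boundary E A \<subseteq> Pow (carrier G)" using edges_subset unfolding boundary_def by blast
  then have "card (boundary E (translate G g A)) = card (boundary E A)"
    unfolding boundary_translate[OF g c(1)]
    by (intro card_image inj_on_subset[OF inj_translate[OF g]])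
  moreover have "infinite (carrier G - translate G g A)"
    using infinite_translate[OF g _ c(3)] translate_Diff[OF g c(1)] by simp
  ultimately show ?thesis
    using A c infinite_translate[OF g c(1,2)] translate_subset[OF g c(1)]
    unfolding min_cut_def cut_def by (simp add: boundary_translate[OF g c(1)])
qed

lemma nested_translate:
  assumes g: "g \<in> carrier G" and AB: "A \<subseteq> carrier G" "B \<subseteq> carrier G" "nested A B"
  shows "nested (translate G g A) (translate G g B)"
proof -
  \<comment> \<open>Disjointness and covering are rewritten as inclusions with a complement, so that
    \<open>translate_mono\<close> and \<open>translate_Diff\<close> settle all cases.\<close>
  consider "A \<subseteq> B" | "B \<subseteq> A" | "A \<subseteq> carrier G - B" | "carrier G - A \<subseteq> B"
    using AB unfolding nested_def by blast
  then show ?thesis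
  proof cases
    case 3
    then show ?thesis
      using translate_mono[of A "carrier G - B" g] translate_Diff[OF g AB(2)]
      unfolding nested_def by blast
  next
    case 4
    then show ?thesis
      using translate_mono[of "carrier G - A" B g] translate_Diff[OF g AB(1)]
      unfolding nested_def by blast
  qed (use translate_mono in \<open>auto simp: nested_def\<close>)
qed

lemma crossing_translate:
  assumes g: "g \<in> carrier G" and A: "A \<subseteq> carrier G"
  shows "translate G g ` crossing A \<subseteq> crossing (translate G g A)"
proof
  fix B assume "B \<in> translate G g ` crossing A"
  then obtain C where C: "min_cut C" "\<not> nested A C" "B = translate G g C"
    unfolding crossing_def by blast
  have sub: "C \<subseteq> carrier G" using C(1) unfolding min_cut_def cut_def by blast
  have "\<not> nested (translate G g A) B"
    using nested_translate[of "inv g" "translate G g A" B] g A sub C(2,3)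
    by (auto simp: translate_inv_translate translate_subset)
  then show "B \<in> crossing (translate G g A)"
    using min_cut_translate[OF g C(1)] C(3) unfolding crossing_def by blast
qed

lemma card_crossing_le:
  assumes g: "g \<in> carrier G" and A: "min_cut A"
  shows "card (crossing A) \<le> card (crossing (translate G g A))"
proof -
  have sub: "A \<subseteq> carrier G" using A unfolding min_cut_def cut_def by blast
  have "crossing A \<subseteq> Pow (carrier G)" unfolding crossing_def min_cut_def cut_def by blast
  then have "card (translate G g ` crossing A) = card (crossing A)"
    by (intro card_image inj_on_subset[OF inj_translate[OF g]])
  then show ?thesis
    using card_mono[OF finite_crossing[OF min_cut_translate[OF g A]] crossing_translate[OF g sub]]
    by simp
qed

lemma optimal_cuts_translate:
  assumes g: "g \<in> carrier G" and A: "A \<in> optimal_cuts"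
  shows "translate G g A \<in> optimal_cuts"
proof -
  have m: "min_cut A" using A unfolding optimal_cuts_def by blast
  then have sub: "A \<subseteq> carrier G" unfolding min_cut_def cut_def by blast
  \<comment> \<open>The reverse inequality is the same lemma for \<open>inv g\<close> and the
    translated cut.\<close>
  have "card (crossing (translate G g A)) = card (crossing A)"
    using card_crossing_le[OF g m] card_crossing_le[of "inv g", OF _ min_cut_translate[OF g m]] g sub
    by (simp add: translate_inv_translate)
  then show ?thesis using A min_cut_translate[OF g m] unfolding optimal_cuts_def by simp
qed

text \<open>Fix an end \<open>x\<close> of a boundary edge of \<open>A\<close>. A transporter
  \<open>g\<close> sends it to one of the finitely many ends of boundary edges of \<open>B\<close>,
  and \<open>g\<close> is recovered from that image as
  \<open>(g \<otimes> x) \<otimes> inv x\<close>.\<close>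

lemma finite_transporter_cuts:
  assumes A: "cut A" and B: "cut B"
  shows "finite {g \<in> carrier G. translate G g A = B}"
proof -
  have sub: "A \<subseteq> carrier G" using A unfolding cut_def by blast
  obtain e where e: "e \<in> boundary E A" using boundary_cut_nonempty[OF A] by blast
  then obtain x where x: "x \<in> e" "x \<in> A" unfolding boundary_def by blast
  have xG: "x \<in> carrier G" using x(2) sub by blast
  let ?N = "\<Union>(boundary E B)"
  have "finite f" if "f \<in> E" for f
    using simple that unfolding simple_graph_def by (metis card.infinite zero_neq_numeral)
  then have "finite ?N" using B unfolding cut_def boundary_def by blast
  moreover have "{g \<in> carrier G. translate G g A = B} \<subseteq> (\<lambda>n. n \<otimes> inv x) ` ?N"
  proof
    fix g assume "g \<in> {g \<in> carrier G. translate G g A = B}"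
    then have g: "g \<in> carrier G" "translate G g A = B" by auto
    have "g \<otimes> x \<in> ?N"
      using translate_in_boundary[OF g(1) sub e] x(1) g(2) unfolding translate_def by blast
    moreover have "g = (g \<otimes> x) \<otimes> inv x" using g(1) xG by (simp add: m_assoc)
    ultimately show "g \<in> (\<lambda>n. n \<otimes> inv x) ` ?N" by blast
  qed
  ultimately show ?thesis using finite_subset by blast
qed

lemma optimal_cuts_cut: "A \<in> optimal_cuts \<Longrightarrow> cut A"
  unfolding optimal_cuts_def min_cut_def by blast

sublocale optimal: invariant_nested_family G optimal_cuts
proof
  show "carrier G \<noteq> {}" using one_closed by blast
  show "A \<noteq> {}" "A \<subseteq> carrier G" "infinite A" if "A \<in> optimal_cuts" for A
    using optimal_cuts_cut[OF that] unfolding cut_def by auto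
  show "carrier G - A \<in> optimal_cuts" if "A \<in> optimal_cuts" for A
    by (rule optimal_cuts_Diff[OF that])
  show "A \<subseteq> B \<or> B \<subseteq> A \<or> A \<inter> B = {} \<or> carrier G \<subseteq> A \<union> B"
    if "A \<in> optimal_cuts" "B \<in> optimal_cuts" for A B
    using optimal_cuts_nested[OF that] unfolding nested_def .
  show "finite {A \<in> optimal_cuts. x \<in> A \<and> y \<notin> A}" if "x \<in> carrier G" "y \<in> carrier G" for x y
    by (rule finite_optimal_cuts_separating[OF that])
  show "translate G g A \<in> optimal_cuts" if "g \<in> carrier G" "A \<in> optimal_cuts" for g A
    by (rule optimal_cuts_translate[OF that])
  show "finite {g \<in> carrier G. translate G g A = B}"
    if "A \<in> optimal_cuts" "B \<in> optimal_cuts" for A B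
    using finite_transporter_cuts that optimal_cuts_cut by blast
  show "optimal_cuts \<noteq> {}" by (rule optimal_cuts_nonempty)
qed

end

section \<open>Translation invariance, local finiteness and connectedness of Cayley graphs\<close>

context group
begin

lemma cayley_edges_translate:
  assumes "S \<subseteq> carrier G" "g \<in> carrier G" "e \<in> cayley_edges G S"
  shows "translate G g e \<in> cayley_edges G S"
proof -
  obtain h s where h: "e = {h, h \<otimes> s}" "h \<in> carrier G" "s \<in> S" "s \<noteq> \<one>"
    using assms(3) unfolding cayley_edges_def by blast
  then have "translate G g e = {g \<otimes> h, (g \<otimes> h) \<otimes> s}"
    unfolding translate_def using assms by (auto simp: m_assoc)
  then show ?thesis unfolding cayley_edges_def using h assms(2) by blast
qed

lemma cayley_locally_finite:
  assumes "finite S" "S \<subseteq> carrier G"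
  shows "finite {e \<in> cayley_edges G S. v \<in> e}"
proof -
  have "{e \<in> cayley_edges G S. v \<in> e}
      \<subseteq> (\<lambda>s. {v, v \<otimes> s}) ` S \<union> (\<lambda>s. {v \<otimes> inv s, v}) ` S"
  proof
    fix e assume "e \<in> {e \<in> cayley_edges G S. v \<in> e}"
    then obtain h s where h: "e = {h, h \<otimes> s}" "h \<in> carrier G" "s \<in> S" "v = h \<or> v = h \<otimes> s"
      unfolding cayley_edges_def by blast
    have "h = h \<otimes> s \<otimes> inv s" using h(2,3) assms(2) by (auto simp: m_assoc)
    then show "e \<in> (\<lambda>s. {v, v \<otimes> s}) ` S \<union> (\<lambda>s. {v \<otimes> inv s, v}) ` S"
      using h by auto
  qed
  then show ?thesis using assms(1) by (meson finite_UnI finite_imageI finite_subset)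
qed

text \<open>An empty boundary makes membership in \<open>C\<close> invariant under right
  multiplication by elements of \<open>S\<close>. Being an equivalence, this also covers inverses,
  hence all of \<open>generate G S\<close>.\<close>

lemma cayley_connected:
  assumes S: "S \<subseteq> carrier G" "generate G S = carrier G"
    and C: "C \<subseteq> carrier G" "C \<noteq> {}" "boundary (cayley_edges G S) C = {}"
  shows "C = carrier G"
proof -
  have edge: "x \<in> C \<longleftrightarrow> x \<otimes> s \<in> C" if "x \<in> carrier G" "s \<in> S" for x s
  proof (cases "s = \<one>")
    case False
    then have "{x, x \<otimes> s} \<in> cayley_edges G S" unfolding cayley_edges_def using that by blast
    then show ?thesis using C(3) unfolding boundary_def by blast
  qed (use that in simp)
  have "\<forall>x\<in>C. x \<otimes> h \<in> C" if "h \<in> generate G S" for h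
    using that
  proof (induction rule: generate.induct)
    case one
    then show ?case using C(1) by auto
  next
    case (incl h)
    then show ?case using edge C(1) by blast
  next
    case (inv h)
    have "x \<otimes> inv h \<otimes> h = x" if "x \<in> C" for x
      using that inv S(1) C(1) by (auto simp: m_assoc subset_iff)
    then show ?case using edge[of _ h] inv S(1) C(1) by (metis inv_closed m_closed subsetD)
  next
    case (eng h1 h2)
    then show ?case using S(2) C(1) by (auto simp: m_assoc[symmetric] subset_iff)
  qed
  moreover obtain g where g: "g \<in> C" using C(2) by blast
  moreover have "x = g \<otimes> (inv g \<otimes> x)" if "x \<in> carrier G" for x
    using that g C(1) by (auto simp: m_assoc[symmetric])
  ultimately show ?thesis using C(1) S(2) by (metis inv_closed m_closed subsetD subsetI subset_antisym)
qed

end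

theorem theorem2:
  fixes G :: "('a, 'm) monoid_scheme"
    and S V\<^sub>K :: "'a set" and E\<^sub>K :: "'a set set"
  defines "X \<equiv> geo_topology (carrier G) (cayley_edges G S)"
    and "K \<equiv> geo_points V\<^sub>K E\<^sub>K"
  assumes "group G"
    and "finite S" and "S \<subseteq> carrier G" and "generate G S = carrier G"
    and "subgraph_of V\<^sub>K E\<^sub>K (carrier G) (cayley_edges G S)"
    and "compactin X K"
    and "\<exists>C\<^sub>1 C\<^sub>2. C\<^sub>1 \<in> connected_components_of (subtopology X (topspace X - K))
           \<and> C\<^sub>2 \<in> connected_components_of (subtopology X (topspace X - K))
           \<and> C\<^sub>1 \<noteq> C\<^sub>2
           \<and> \<not> geo_bounded (carrier G) (cayley_edges G S) C\<^sub>1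
           \<and> \<not> geo_bounded (carrier G) (cayley_edges G S) C\<^sub>2"
  shows "\<exists>(V :: 'a set set set) E \<phi>.
           simplicial_tree V E \<and> graph_action G V E \<phi>
           \<and> nontrivial_action G V E \<phi>
           \<and> (\<forall>e\<in>E. finite (edge_stabilizer G \<phi> e))"
proof -
  interpret group G by fact
  interpret K: compact_subgraph "carrier G" "cayley_edges G S" V\<^sub>K E\<^sub>K
    using assms simple_graph_cayley by unfold_locales (simp_all add: X_def K_def)
  have ends: "\<exists>A\<subseteq>carrier G. infinite A \<and> infinite (carrier G - A) \<and> finite (boundary (cayley_edges G S) A)"
    using assms(9) K.infinite_cut_exists[OF _ _ _ _ _ cayley_locally_finite[OF assms(4,5)]]
    unfolding X_def K_def by blast
  interpret multi_ended_group_graph G "cayley_edges G S"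
    by unfold_locales
      (use ends cayley_connected[OF assms(5,6)] cayley_edges_translate[OF assms(5)]
        simple_graph_cayley[OF assms(5)] in blast)+
  show ?thesis
    using optimal.tree optimal.graph_action_act optimal.nontrivial_act
      optimal.finite_edge_stabilizer by blast
qed

end
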